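(* Let $N,N_t,N_r\ge1$ be integers with $N\le N_t$, and let $\rho>0$, $T>0$; if $T<1$ assume $N\ge 2$. Consider the orthogonal random precoding scheme with $N$ precoding vectors and an antenna-selection receiver with $N_r$ antennas, with downlink coverage probability $$\mathcal P^{(T)}_{AS}=\mathbf P\Big\{\max_{1\le n\le N,\ 1\le r\le N_r}SINR_{n,r}>T\Big\}.$$ Then $$\mathcal P^{(T)}_{AS}=\begin{cases}1-\left(1-\dfrac{N}{(T+1)^{N-1}}\,e^{-TN/\rho}\right)^{N_r}, & T\ge 1,\\[2mm] 1-\left[1-\left(\mathcal P^{(T)}_1+\displaystyle\sum_{k=2}^{m-1}\mathcal P^{(T)}_k+\mathcal P^{(T)}_m\right)\right]^{N_r}, & T<1,\end{cases}$$ where $m=\lceil 1/T\rceil$ (the middle sum is empty if $m=2$) and $\mathcal P^{(T)}_1,\mathcal P^{(T)}_k,\mathcal P^{(T)}_m$ are the explicit quantities defined in the context.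
   Context: Model. $H\in\mathbb C^{N_r\times N_t}$ has i.i.d. circularly symmetric complex Gaussian entries $\mathcal{CN}(0,1)$, and $h_r^T$ denotes its $r$th row (the channel to the $r$th receive antenna). $\phi_1,\dots,\phi_N\in\mathbb C^{N_t\times1}$ are (random) orthonormal precoding vectors, independent of $H$. $\rho>0$ is the average SNR. The signal-to-interference-plus-noise ratio of the $n$th beam at the $r$th antenna is $$SINR_{n,r}=\frac{|h_r^T\phi_n|^2}{\frac N\rho+\sum_{i\ne n,\,1\le i\le N}|h_r^T\phi_i|^2}.$$ Auxiliary quantities (for $0<T<1$, $N\ge2$, $m=\lceil1/T\rceil\ge 2$). Convention $0^0=1$ and $\binom{a}{b}=0$ for $b>a$. For $1\le k\le m-1$ set $b_k=\dfrac{TN}{\rho(1/k-T)}$. For an integer $p\ge1$ and an expression $g$ depending on the summation indices $i,l$, $$\xi_p(g)=\frac{N}{(N-2)!}\sum_{t=1}^{p}\binom{N-1}{t-1}(-1)^{t+1}\sum_{i=0}^{N-2}\binom{N-2}{i}(1-t)^i\,i!\sum_{l=0}^{i}g(i,l).$$ Then $$\mathcal P^{(T)}_1=\frac{N}{(N-2)!}\left(e^{-TN/\rho}C_1+C_2\right),$$ $$\mathcal P^{(T)}_k=\xi_k\!\left(e^{-TN/\rho}\frac{T^l}{l!}D_1-\frac{1}{(k-1)^l\,l!}D_2\right)+\xi_k\!\left(\frac{1}{k^l\,l!}E_1-\frac{1}{(k-1)^l\,l!}E_2\right),\quad 2\le k\le m-1,$$ $$\mathcal P^{(T)}_m=\xi_m\!\left(e^{-TN/\rho}\frac{T^l}{l!}F_1-\frac{1}{(m-1)^l\,l!}F_2\right),$$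 where $D_j,E_j$ depend on $k,i,l$ and $F_j$ on $m,i,l$: $$C_1=\frac{(N-2)!}{(T+1)^{N-1}}\Big(1-e^{-(T+1)b_1}\sum_{l=0}^{N-2}\frac{(T+1)^lb_1^l}{l!}\Big),\qquad C_2=\frac{(N-2)!}{2^{N-1}}e^{-2b_1}\sum_{l=0}^{N-2}\frac{2^lb_1^l}{l!},$$ $$D_1=\sum_{v=0}^{l}\binom lv\Big(\frac N\rho\Big)^{l-v}\frac{(N-i+v-2)!}{(T+1)^{N-i+v-1}}\sum_{u=0}^{N-i+v-2}\frac{(T+1)^u}{u!}\Big(e^{-(T+1)b_{k-1}}b_{k-1}^u-e^{-(T+1)b_k}b_k^u\Big),$$ $$D_2=\frac{(N-i+l-2)!}{(\frac{k}{k-1})^{N-i+l-1}}\Big[e^{-\frac{k}{k-1}b_{k-1}}\sum_{u=0}^{N-i+l-2}\Big(\frac{k}{k-1}\Big)^u\frac{b_{k-1}^u}{u!}-e^{-\frac{k}{k-1}b_k}\sum_{u=0}^{N-i+l-2}\Big(\frac{k}{k-1}\Big)^u\frac{b_k^u}{u!}\Big],$$ $$E_1=\frac{(N-i+l-2)!}{(\frac{k+1}{k})^{N-i+l-1}}e^{-\frac{k+1}{k}b_k}\sum_{u=0}^{N-i+l-2}\Big(\frac{k+1}{k}\Big)^u\frac{b_k^u}{u!},$$ $$E_2=\frac{(N-i+l-2)!}{(\frac{k}{k-1})^{N-i+l-1}}e^{-\frac{k}{k-1}b_k}\sum_{u=0}^{N-i+l-2}\Big(\frac{k}{k-1}\Big)^u\frac{b_k^u}{u!},$$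 $$F_1=\sum_{v=0}^{l}\binom lv\Big(\frac N\rho\Big)^{l-v}\frac{(N-i+v-2)!}{(T+1)^{N-i+v-1}}e^{-(T+1)b_{m-1}}\sum_{u=0}^{N-i+v-2}(T+1)^u\frac{b_{m-1}^u}{u!},$$ $$F_2=\frac{(N-i+l-2)!}{(\frac{m}{m-1})^{N-i+l-1}}e^{-\frac{m}{m-1}b_{m-1}}\sum_{u=0}^{N-i+l-2}\Big(\frac{m}{m-1}\Big)^u\frac{b_{m-1}^u}{u!}.$$ *)

theory Defs
  imports "HOL-Probability.Probability"
begin

section \<open>Channel and precoding model\<close>

text \<open>The circularly symmetric law CN(0,1): the real and imaginary parts are independent
  N(0,1/2). The second argument of \<^const>\<open>normal_density\<close> is the standard deviation.\<close>

definition std_complex_gaussian :: "'a measure \<Rightarrow> ('a \<Rightarrow> complex) \<Rightarrow> bool" where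
  "std_complex_gaussian M X \<longleftrightarrow>
     prob_space.indep_var M borel (\<lambda>\<omega>. Re (X \<omega>)) borel (\<lambda>\<omega>. Im (X \<omega>)) \<and>
     distributed M lborel (\<lambda>\<omega>. Re (X \<omega>)) (normal_density 0 (sqrt (1 / 2))) \<and>
     distributed M lborel (\<lambda>\<omega>. Im (X \<omega>)) (normal_density 0 (sqrt (1 / 2)))"

definition iid_gaussian_channel :: "'a measure \<Rightarrow> ('a \<Rightarrow> complex ^ 'nt ^ 'nr) \<Rightarrow> bool" where
  "iid_gaussian_channel M H \<longleftrightarrow>
     prob_space.indep_vars M (\<lambda>_. borel) (\<lambda>(r, j) \<omega>. H \<omega> $ r $ j) (UNIV :: ('nr \<times> 'nt) set) \<and>
     (\<forall>r j. std_complex_gaussian M (\<lambda>\<omega>. H \<omega> $ r $ j))"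

text \<open>The inner product of the type class \<^class>\<open>real_inner\<close> on complex vectors is only the real
  part of the Hermitian one.\<close>

definition hermitian_inner :: "complex ^ 'n \<Rightarrow> complex ^ 'n \<Rightarrow> complex" where
  "hermitian_inner u v = (\<Sum>j\<in>UNIV. cnj (u $ j) * v $ j)"

definition orthonormal_family :: "nat \<Rightarrow> (nat \<Rightarrow> complex ^ 'n) \<Rightarrow> bool" where
  "orthonormal_family N \<phi> \<longleftrightarrow>
     (\<forall>n\<in>{1..N}. \<forall>i\<in>{1..N}. hermitian_inner (\<phi> n) (\<phi> i) = (if n = i then 1 else 0))"

text \<open>Independence of two random variables. Unlike in \<^const>\<open>prob_space.indep_var\<close>, the two
  codomain types may differ; the two set systems below are the sigma algebras generated by
  \<open>X\<close> and \<open>Y\<close>.\<close>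

definition indep_rvs ::
  "'a measure \<Rightarrow> 'b measure \<Rightarrow> ('a \<Rightarrow> 'b) \<Rightarrow> 'c measure \<Rightarrow> ('a \<Rightarrow> 'c) \<Rightarrow> bool" where
  "indep_rvs M A X B Y \<longleftrightarrow>
     X \<in> measurable M A \<and> Y \<in> measurable M B \<and>
     prob_space.indep_set M {X -` S \<inter> space M | S. S \<in> sets A} {Y -` S \<inter> space M | S. S \<in> sets B}"

text \<open>The entry \<open>(h *v \<phi> n) $ r\<close> is the unconjugated product of the \<open>r\<close>-th row of \<open>h\<close> with the
  beam \<open>\<phi> n\<close>.\<close>

definition sinr ::
  "nat \<Rightarrow> real \<Rightarrow> complex ^ 'nt ^ 'nr \<Rightarrow> (nat \<Rightarrow> complex ^ 'nt) \<Rightarrow> nat \<Rightarrow> 'nr \<Rightarrow> real" where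
  "sinr N \<rho> h \<phi> n r =
     (cmod ((h *v \<phi> n) $ r))\<^sup>2 /
     (real N / \<rho> + (\<Sum>i\<in>{1..N} - {n}. (cmod ((h *v \<phi> i) $ r))\<^sup>2))"

definition coverage_AS ::
  "'a measure \<Rightarrow> nat \<Rightarrow> real \<Rightarrow> real \<Rightarrow> ('a \<Rightarrow> complex ^ 'nt ^ 'nr) \<Rightarrow>
     (nat \<Rightarrow> 'a \<Rightarrow> complex ^ 'nt) \<Rightarrow> real" where
  "coverage_AS M N \<rho> T H \<phi> =
     measure M {\<omega> \<in> space M.
       (MAX (n, r) \<in> {1..N} \<times> UNIV. sinr N \<rho> (H \<omega>) (\<lambda>i. \<phi> i \<omega>) n r) > T}"


section \<open>Closed-form terms for thresholds below one\<close>

text \<open>Meaningful for \<open>N \<ge> 2\<close>, \<open>0 < T < 1\<close>, \<open>m = \<lceil>1/T\<rceil>\<close>, with \<open>1 \<le> k \<le> m - 1\<close> in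
  \<open>b_th\<close> and \<open>2 \<le> k \<le> m - 1\<close> in the other terms. In this range, and for
  \<open>l \<le> i \<le> N - 2\<close>, no subtraction of naturals truncates.\<close>

definition b_th :: "nat \<Rightarrow> real \<Rightarrow> real \<Rightarrow> nat \<Rightarrow> real" where
  "b_th N \<rho> T k = T * real N / (\<rho> * (1 / real k - T))"

definition xi :: "nat \<Rightarrow> nat \<Rightarrow> (nat \<Rightarrow> nat \<Rightarrow> real) \<Rightarrow> real" where
  "xi N p g =
     real N / fact (N - 2) *
     (\<Sum>t = 1..p. real ((N - 1) choose (t - 1)) * (-1) ^ (t + 1) *
       (\<Sum>i = 0..N - 2. real ((N - 2) choose i) * (1 - real t) ^ i * fact i *
         (\<Sum>l = 0..i. g i l)))"

definition C1 :: "nat \<Rightarrow> real \<Rightarrow> real \<Rightarrow> real" where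
  "C1 N \<rho> T =
     fact (N - 2) / (T + 1) ^ (N - 1) *
     (1 - exp (- (T + 1) * b_th N \<rho> T 1) *
        (\<Sum>l = 0..N - 2. (T + 1) ^ l * b_th N \<rho> T 1 ^ l / fact l))"

definition C2 :: "nat \<Rightarrow> real \<Rightarrow> real \<Rightarrow> real" where
  "C2 N \<rho> T =
     fact (N - 2) / 2 ^ (N - 1) * exp (- 2 * b_th N \<rho> T 1) *
     (\<Sum>l = 0..N - 2. 2 ^ l * b_th N \<rho> T 1 ^ l / fact l)"

definition D1 :: "nat \<Rightarrow> real \<Rightarrow> real \<Rightarrow> nat \<Rightarrow> nat \<Rightarrow> nat \<Rightarrow> real" where
  "D1 N \<rho> T k i l =
     (\<Sum>v = 0..l. real (l choose v) * (real N / \<rho>) ^ (l - v) *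
        (fact (N - i + v - 2) / (T + 1) ^ (N - i + v - 1)) *
        (\<Sum>u = 0..N - i + v - 2. (T + 1) ^ u / fact u *
           (exp (- (T + 1) * b_th N \<rho> T (k - 1)) * b_th N \<rho> T (k - 1) ^ u
            - exp (- (T + 1) * b_th N \<rho> T k) * b_th N \<rho> T k ^ u)))"

definition D2 :: "nat \<Rightarrow> real \<Rightarrow> real \<Rightarrow> nat \<Rightarrow> nat \<Rightarrow> nat \<Rightarrow> real" where
  "D2 N \<rho> T k i l =
     fact (N - i + l - 2) / (real k / (real k - 1)) ^ (N - i + l - 1) *
     (exp (- (real k / (real k - 1)) * b_th N \<rho> T (k - 1)) *
        (\<Sum>u = 0..N - i + l - 2. (real k / (real k - 1)) ^ u * (b_th N \<rho> T (k - 1) ^ u / fact u))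
      - exp (- (real k / (real k - 1)) * b_th N \<rho> T k) *
        (\<Sum>u = 0..N - i + l - 2. (real k / (real k - 1)) ^ u * (b_th N \<rho> T k ^ u / fact u)))"

definition E1 :: "nat \<Rightarrow> real \<Rightarrow> real \<Rightarrow> nat \<Rightarrow> nat \<Rightarrow> nat \<Rightarrow> real" where
  "E1 N \<rho> T k i l =
     fact (N - i + l - 2) / ((real k + 1) / real k) ^ (N - i + l - 1) *
     exp (- ((real k + 1) / real k) * b_th N \<rho> T k) *
     (\<Sum>u = 0..N - i + l - 2. ((real k + 1) / real k) ^ u * (b_th N \<rho> T k ^ u / fact u))"

definition E2 :: "nat \<Rightarrow> real \<Rightarrow> real \<Rightarrow> nat \<Rightarrow> nat \<Rightarrow> nat \<Rightarrow> real" where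
  "E2 N \<rho> T k i l =
     fact (N - i + l - 2) / (real k / (real k - 1)) ^ (N - i + l - 1) *
     exp (- (real k / (real k - 1)) * b_th N \<rho> T k) *
     (\<Sum>u = 0..N - i + l - 2. (real k / (real k - 1)) ^ u * (b_th N \<rho> T k ^ u / fact u))"

definition F1 :: "nat \<Rightarrow> real \<Rightarrow> real \<Rightarrow> nat \<Rightarrow> nat \<Rightarrow> nat \<Rightarrow> real" where
  "F1 N \<rho> T m i l =
     (\<Sum>v = 0..l. real (l choose v) * (real N / \<rho>) ^ (l - v) *
        (fact (N - i + v - 2) / (T + 1) ^ (N - i + v - 1)) *
        exp (- (T + 1) * b_th N \<rho> T (m - 1)) *
        (\<Sum>u = 0..N - i + v - 2. (T + 1) ^ u * (b_th N \<rho> T (m - 1) ^ u / fact u)))"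

definition F2 :: "nat \<Rightarrow> real \<Rightarrow> real \<Rightarrow> nat \<Rightarrow> nat \<Rightarrow> nat \<Rightarrow> real" where
  "F2 N \<rho> T m i l =
     fact (N - i + l - 2) / (real m / (real m - 1)) ^ (N - i + l - 1) *
     exp (- (real m / (real m - 1)) * b_th N \<rho> T (m - 1)) *
     (\<Sum>u = 0..N - i + l - 2. (real m / (real m - 1)) ^ u * (b_th N \<rho> T (m - 1) ^ u / fact u))"

definition P_first :: "nat \<Rightarrow> real \<Rightarrow> real \<Rightarrow> real" where
  "P_first N \<rho> T =
     real N / fact (N - 2) * (exp (- (T * real N / \<rho>)) * C1 N \<rho> T + C2 N \<rho> T)"

definition P_mid :: "nat \<Rightarrow> real \<Rightarrow> real \<Rightarrow> nat \<Rightarrow> real" where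
  "P_mid N \<rho> T k =
     xi N k (\<lambda>i l. exp (- (T * real N / \<rho>)) * (T ^ l / fact l) * D1 N \<rho> T k i l
                    - 1 / ((real k - 1) ^ l * fact l) * D2 N \<rho> T k i l)
     + xi N k (\<lambda>i l. 1 / (real k ^ l * fact l) * E1 N \<rho> T k i l
                      - 1 / ((real k - 1) ^ l * fact l) * E2 N \<rho> T k i l)"

definition P_last :: "nat \<Rightarrow> real \<Rightarrow> real \<Rightarrow> nat \<Rightarrow> real" where
  "P_last N \<rho> T m =
     xi N m (\<lambda>i l. exp (- (T * real N / \<rho>)) * (T ^ l / fact l) * F1 N \<rho> T m i l
                    - 1 / ((real m - 1) ^ l * fact l) * F2 N \<rho> T m i l)"

end

theory Submission
  imports Defs
begin

text \<open>Since the Gaussian law is invariant under unitary maps of the rows, the beams may be replaced by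
  distinct coordinate axes once they are fixed by Fubini; then the squared gains are independent unit
  exponentials and the antennas are independent. For one antenna the threshold is exceeded by some beam
  exactly when it is exceeded by the strongest one. Conditioning on the largest gain \<open>x\<close>, the sum \<open>z\<close> of the
  other \<open>N - 1\<close> gains is a sum of exponentials truncated at \<open>x\<close>, whose density is an alternating sum of
  truncated powers \<open>(z - j x)\<^sup>N\<^sup>-\<^sup>2 exp (- z)\<close>. Integrating the \<open>j\<close>-th power over \<open>x > T (N / \<rho> + z)\<close> gives \<open>0\<close>
  if \<open>j T \<ge> 1\<close>, which leaves only \<open>j = 0\<close> for \<open>T \<ge> 1\<close>. The paper's terms \<open>P_mid\<close> are differences of
  consecutive terms of the shape of \<open>P_last\<close>, so their sum telescopes to these integrals.\<close>

section \<open>Gaussian vectors and linear isometries\<close>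

text \<open>The given terms sort coverage by \<open>z / x\<close>: \<open>P_mid N \<rho> T k\<close>
  is the part with \<open>k - 1 \<le> z / x < k\<close>, where exactly the powers with
  \<open>j < k\<close> are active, and \<open>P_first\<close>, \<open>P_last\<close> are the two
  ends; \<open>x > T * (c + z)\<close> with \<open>c = N / \<rho>\<close> forces
  \<open>z / x < 1 / T\<close>, so nothing lies beyond \<open>m\<close>. The proof sorts by
  \<open>j\<close> instead, and the telescoping is the summation by parts between both sortings. The
  \<open>j\<close>-th power contributes for \<open>T * (c + z) < x \<le> z / j\<close>. The two ends
  of this interval meet at \<open>z = b_th N \<rho> T j\<close>, which is the origin of these
  constants; if \<open>j * T \<ge> 1\<close>, the interval is empty for every
  \<open>z \<ge> 0\<close>. The obstacle is the sign: the density is an alternating sum, while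
  Tonelli and the densities of sums are handled with nonnegative integrals. So the whole density
  stays one nonnegative function until the double integral is reached, every truncated power is
  integrated on its own as a nonnegative function, and only the finite combination of these
  integrals is taken with Bochner integrals.\<close>

lemma nn_integral_lborel_translation:
  fixes g :: "'a::euclidean_space \<Rightarrow> ennreal"
  assumes [measurable]: "g \<in> borel_measurable borel"
  shows "(\<integral>\<^sup>+x. g (c + x) \<partial>lborel) = (\<integral>\<^sup>+x. g x \<partial>lborel)"
  by (subst (2) lborel_distr_plus[of c, symmetric]) (simp add: nn_integral_distr)

text \<open>Uniqueness of Haar measure: integrate \<open>indicator A x * indicator B (x - f y)\<close> in both orders,
  for \<open>B\<close> the unit ball.\<close>

lemma lborel_distr_linear_isometry:
  fixes f :: "'a::euclidean_space \<Rightarrow> 'a"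
  assumes lin: "linear f" and iso: "\<And>x. norm (f x) = norm x"
  shows "distr lborel borel f = lborel"
proof (rule measure_eqI)
  have inj: "inj f"
    using lin iso by (metis linear_injective_0 norm_eq_zero)
  then have surj: "surj f"
    using lin linear_injective_imp_surjective by blast
  have [measurable]: "f \<in> borel_measurable borel"
    using lin by (intro borel_measurable_continuous_onI linear_continuous_on linear_conv_bounded_linear[THEN iffD1])
  fix A assume "A \<in> sets (distr lborel borel f)"
  then have A[measurable]: "A \<in> sets borel" by simp
  define B where "B = ball (0::'a) 1"
  have B[measurable]: "B \<in> sets borel" by (simp add: B_def)
  have Bf: "indicator B (f x) = (indicator B x :: ennreal)" for x
    by (simp add: B_def iso indicator_def)
  have Bs: "indicator B (x - y) = (indicator B (y - x) :: ennreal)" for x y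
    by (simp add: B_def indicator_def norm_minus_commute)
  let ?K = "\<integral>\<^sup>+x. \<integral>\<^sup>+y. indicator A x * indicator B (x - f y) \<partial>lborel \<partial>lborel"
  \<comment> \<open>With \<open>x = f x'\<close> the inner integral is the volume of the unit ball
    around \<open>x'\<close>, because \<open>f\<close> preserves distances.\<close>
  have "?K = (\<integral>\<^sup>+x. indicator A x * emeasure lborel B \<partial>lborel)"
  proof (rule nn_integral_cong)
    fix x
    obtain x' where x': "x = f x'" using surj by blast
    have "(\<integral>\<^sup>+y. indicator A x * indicator B (x - f y) \<partial>lborel)
        = indicator A x * (\<integral>\<^sup>+y. indicator B (x - f y) \<partial>lborel)"
      by (intro nn_integral_cmult) measurable
    also have "(\<integral>\<^sup>+y. indicator B (x - f y) \<partial>lborel) = (\<integral>\<^sup>+y. indicator B (- x' + y) \<partial>lborel)"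
      unfolding x' linear_diff[OF lin, symmetric] Bf by (simp add: Bs)
    also have "\<dots> = emeasure lborel B"
      by (subst nn_integral_lborel_translation) auto
    finally show "(\<integral>\<^sup>+y. indicator A x * indicator B (x - f y) \<partial>lborel) = indicator A x * emeasure lborel B" .
  qed
  also have "\<dots> = emeasure lborel A * emeasure lborel B"
    by (simp add: nn_integral_multc)
  finally have K1: "?K = emeasure lborel A * emeasure lborel B" .
  have "?K = (\<integral>\<^sup>+y. \<integral>\<^sup>+x. indicator A x * indicator B (x - f y) \<partial>lborel \<partial>lborel)"
    by (rule lborel_pair.Fubini') measurable
  \<comment> \<open>Shifting \<open>x\<close> by \<open>f y\<close> frees \<open>B\<close> from
    \<open>y\<close>. The shift left in \<open>A\<close> is some \<open>f x'\<close>, so a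
    translation of \<open>y\<close> removes it and the preimage of \<open>A\<close> remains.\<close>
  also have "\<dots> = (\<integral>\<^sup>+y. \<integral>\<^sup>+x. indicator A (f y + x) * indicator B x \<partial>lborel \<partial>lborel)"
  proof (rule nn_integral_cong)
    fix y
    show "(\<integral>\<^sup>+x. indicator A x * indicator B (x - f y) \<partial>lborel)
        = (\<integral>\<^sup>+x. indicator A (f y + x) * indicator B x \<partial>lborel)"
      by (subst nn_integral_lborel_translation[of _ "f y", symmetric]) auto
  qed
  also have "\<dots> = (\<integral>\<^sup>+x. \<integral>\<^sup>+y. indicator A (f y + x) * indicator B x \<partial>lborel \<partial>lborel)"
    by (rule lborel_pair.Fubini') measurable
  also have "\<dots> = (\<integral>\<^sup>+x. emeasure (distr lborel borel f) A * indicator B x \<partial>lborel)"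
  proof (rule nn_integral_cong)
    fix x
    obtain x' where x': "x = f x'" using surj by blast
    have "(\<integral>\<^sup>+y. indicator A (f y + x) * indicator B x \<partial>lborel)
        = (\<integral>\<^sup>+y. indicator A (f y + x) \<partial>lborel) * indicator B x"
      by (intro nn_integral_multc) measurable
    also have "(\<integral>\<^sup>+y. indicator A (f y + x) \<partial>lborel) = (\<integral>\<^sup>+y. indicator A (f (x' + y)) \<partial>lborel)"
      unfolding x' by (simp add: linear_add[OF lin] add.commute)
    also have "\<dots> = (\<integral>\<^sup>+y. indicator A (f y) \<partial>lborel)"
      by (rule nn_integral_lborel_translation) measurable
    also have "\<dots> = emeasure (distr lborel borel f) A"
      by (subst nn_integral_indicator[symmetric], simp, subst nn_integral_distr) auto
    finally show "(\<integral>\<^sup>+y. indicator A (f y + x) * indicator B x \<partial>lborel)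
        = emeasure (distr lborel borel f) A * indicator B x" .
  qed
  also have "\<dots> = emeasure (distr lborel borel f) A * emeasure lborel B"
    by (simp add: nn_integral_cmult)
  finally have "emeasure (distr lborel borel f) A * emeasure lborel B = emeasure lborel A * emeasure lborel B"
    using K1 by simp
  moreover have "emeasure lborel B \<noteq> 0" "emeasure lborel B \<noteq> \<infinity>"
    using emeasure_ball[of 1 "0::'a"] less_imp_neq[OF unit_ball_vol_pos[of "real DIM('a)"]] by (auto simp: B_def)
  ultimately show "emeasure (distr lborel borel f) A = emeasure lborel A"
    by (metis mult_divide_eq_ennreal infinity_ennreal_def)
qed simp

text \<open>Each step of the induction composes with the Householder reflection that swaps \<open>f (a k0)\<close> and \<open>b k0\<close>.\<close>

lemma linear_isometry_orthonormal_family: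
  fixes a b :: "'k \<Rightarrow> 'e::real_inner"
  assumes "finite K"
    and "\<And>k l. k \<in> K \<Longrightarrow> l \<in> K \<Longrightarrow> a k \<bullet> a l = (if k = l then 1 else 0)"
    and "\<And>k l. k \<in> K \<Longrightarrow> l \<in> K \<Longrightarrow> b k \<bullet> b l = (if k = l then 1 else 0)"
  shows "\<exists>f. linear f \<and> (\<forall>x y. f x \<bullet> f y = x \<bullet> y) \<and> (\<forall>k\<in>K. f (a k) = b k)"
  using assms
proof (induction K)
  case empty
  show ?case by (intro exI[of _ id]) (auto simp: linear_id id_def[symmetric])
next
  case (insert k0 K)
  have "\<exists>f. linear f \<and> (\<forall>x y. f x \<bullet> f y = x \<bullet> y) \<and> (\<forall>k\<in>K. f (a k) = b k)"
    using insert.prems by (intro insert.IH) simp_all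
  then obtain f where f: "linear f" "\<And>x y. f x \<bullet> f y = x \<bullet> y" "\<And>k. k \<in> K \<Longrightarrow> f (a k) = b k"
    by blast
  define w where "w = f (a k0) - b k0"
  define R where "R x = x - (2 * (x \<bullet> w) / (w \<bullet> w)) *\<^sub>R w" for x
  have linR: "linear R"
    by (rule linearI) (auto simp: R_def inner_add_left algebra_simps add_divide_distrib)
  have isoR: "R x \<bullet> R y = x \<bullet> y" for x y
  proof (cases "w = 0")
    case False
    have "R x \<bullet> R y = x \<bullet> y - 2 * (y \<bullet> w) / (w \<bullet> w) * (x \<bullet> w) - 2 * (x \<bullet> w) / (w \<bullet> w) * (y \<bullet> w)
        + 2 * (x \<bullet> w) / (w \<bullet> w) * (2 * (y \<bullet> w) / (w \<bullet> w)) * (w \<bullet> w)"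
      by (simp add: R_def inner_diff_left inner_diff_right inner_commute)
    also have "\<dots> = x \<bullet> y" using False by simp
    finally show ?thesis .
  qed (simp add: R_def)
  \<comment> \<open>Both vectors whose difference is \<open>w\<close> are orthogonal to the earlier
    \<open>b k\<close>, so the reflection leaves these alone.\<close>
  have "R (b k) = b k" if "k \<in> K" for k
  proof -
    have "b k \<bullet> f (a k0) = 0"
      using insert.prems(1)[of k k0] insert.hyps that f(2)[of "a k" "a k0"] f(3)[OF that] by auto
    moreover have "b k \<bullet> b k0 = 0"
      using insert.prems(2)[of k k0] insert.hyps that by auto
    ultimately show ?thesis by (simp add: R_def w_def inner_diff_right)
  qed
  moreover have "R (f (a k0)) = b k0"
  proof (cases "w = 0")
    case False
    have 1: "f (a k0) \<bullet> f (a k0) = 1" "b k0 \<bullet> b k0 = 1"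
      using insert.prems f(2) by auto
    \<comment> \<open>Since both vectors have length one, the reflection of \<open>f (a k0)\<close>
      subtracts exactly \<open>w\<close>.\<close>
    then have ww: "2 * (f (a k0) \<bullet> w) = w \<bullet> w"
      by (simp add: w_def inner_diff_left inner_diff_right inner_commute)
    have one: "2 * (f (a k0) \<bullet> w) / (w \<bullet> w) = 1" unfolding ww using False by simp
    have "R (f (a k0)) = f (a k0) - w" by (simp only: R_def one scaleR_one)
    then show ?thesis by (simp add: w_def)
  qed (auto simp: R_def w_def)
  ultimately show ?case
    using f isoR linear_compose[OF f(1) linR] by (intro exI[of _ "R \<circ> f"]) (auto simp: o_def)
qed

section \<open>The standard Gaussian measure on a Euclidean space\<close>

definition std_gauss :: "'e::euclidean_space measure" where
  "std_gauss = density lborel (\<lambda>x. ennreal (\<Prod>b\<in>Basis. normal_density 0 (sqrt (1/2)) (x \<bullet> b)))"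

text \<open>The source of the invariance: the product density depends on \<open>x\<close> through
  its norm alone.\<close>

lemma prod_normal_density_half:
  fixes x :: "'e::euclidean_space"
  shows "(\<Prod>b\<in>Basis. normal_density 0 (sqrt (1/2)) (x \<bullet> b)) = exp (- (norm x)\<^sup>2) / sqrt pi ^ DIM('e)"
proof -
  have "(\<Prod>b\<in>Basis. normal_density 0 (sqrt (1/2)) (x \<bullet> b)) = (\<Prod>b\<in>Basis. exp (- (x \<bullet> b)\<^sup>2) / sqrt pi)"
    by (intro prod.cong) (auto simp: normal_density_def)
  also have "\<dots> = exp (- (\<Sum>b\<in>Basis. (x \<bullet> b)\<^sup>2)) / sqrt pi ^ DIM('e)"
    by (simp add: prod_dividef exp_sum sum_negf[symmetric])
  also have "(\<Sum>b\<in>Basis. (x \<bullet> b)\<^sup>2) = (norm x)\<^sup>2"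
    by (subst power2_norm_eq_inner, subst euclidean_inner) (simp add: power2_eq_square)
  finally show ?thesis .
qed

lemma std_gauss_eq:
  "(std_gauss :: 'e::euclidean_space measure) = density lborel (\<lambda>x. ennreal (exp (- (norm x)\<^sup>2) / sqrt pi ^ DIM('e)))"
  by (simp add: std_gauss_def prod_normal_density_half)

lemma sets_std_gauss[measurable_cong, simp]: "sets std_gauss = sets borel"
  by (simp add: std_gauss_def)

lemma space_std_gauss[simp]: "space std_gauss = UNIV"
  by (simp add: std_gauss_def)

lemma std_gauss_distr_linear_isometry:
  fixes f :: "'e::euclidean_space \<Rightarrow> 'e"
  assumes lin: "linear f" and iso: "\<And>x. norm (f x) = norm x"
  shows "distr std_gauss borel f = std_gauss"
proof (rule measure_eqI)
  have [measurable]: "f \<in> borel_measurable borel"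
    using lin by (intro borel_measurable_continuous_onI linear_continuous_on linear_conv_bounded_linear[THEN iffD1])
  fix A assume "A \<in> sets (distr std_gauss borel f)"
  then have A[measurable]: "A \<in> sets borel" by simp
  let ?g = "\<lambda>x::'e. ennreal (exp (- (norm x)\<^sup>2) / sqrt pi ^ DIM('e))"
  have "emeasure std_gauss A = (\<integral>\<^sup>+x. ?g x * indicator A x \<partial>distr lborel borel f)"
    by (simp add: std_gauss_eq emeasure_density lborel_distr_linear_isometry[OF assms])
  also have "\<dots> = (\<integral>\<^sup>+x. ?g (f x) * indicator A (f x) \<partial>lborel)"
    by (intro nn_integral_distr) measurable
  also have "\<dots> = (\<integral>\<^sup>+x. ?g x * indicator (f -` A) x \<partial>lborel)"
    by (simp add: iso indicator_def)
  also have "\<dots> = emeasure std_gauss (f -` A)"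
    using measurable_sets_borel[of f borel A] by (simp add: std_gauss_eq emeasure_density)
  also have "\<dots> = emeasure (distr std_gauss borel f) A"
    by (subst emeasure_distr) auto
  finally show "emeasure (distr std_gauss borel f) A = emeasure std_gauss A" by simp
qed simp

definition normal_half :: "real measure" where
  "normal_half = density lborel (\<lambda>x. ennreal (normal_density 0 (sqrt (1/2)) x))"

lemma emeasure_std_gauss_box:
  fixes l u :: "'e::euclidean_space"
  shows "emeasure std_gauss (box l u) =
    (\<Prod>b\<in>Basis. emeasure normal_half {l \<bullet> b <..< u \<bullet> b})"
proof -
  let ?n = "\<lambda>x. ennreal (normal_density 0 (sqrt (1/2)) x)"
  have "emeasure std_gauss (box l u) =
     (\<integral>\<^sup>+x. ennreal (\<Prod>b\<in>Basis. normal_density 0 (sqrt (1/2)) (x \<bullet> b)) * indicator (box l u) x \<partial>lborel)"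
    by (simp add: std_gauss_def emeasure_density)
  also have "\<dots> = (\<integral>\<^sup>+x. (\<Prod>b\<in>Basis. (\<lambda>y. ?n y * indicator {l \<bullet> b <..< u \<bullet> b} y) (x \<bullet> b)) \<partial>lborel)"
  proof (intro nn_integral_cong)
    fix x :: 'e
    have "(\<Prod>b\<in>Basis. indicator {l \<bullet> b <..< u \<bullet> b} (x \<bullet> b)) = (indicator (box l u) x :: ennreal)"
    proof (cases "x \<in> box l u")
      case False
      then obtain b where "b \<in> Basis" "x \<bullet> b \<notin> {l \<bullet> b <..< u \<bullet> b}" by (auto simp: box_def)
      then have "(\<Prod>b\<in>Basis. indicator {l \<bullet> b <..< u \<bullet> b} (x \<bullet> b)) = (0::ennreal)"
        using \<open>b \<in> Basis\<close> by (intro prod_zero bexI[of _ b]) auto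
      then show ?thesis using False by simp
    qed (auto simp: box_def indicator_def)
    then show "ennreal (\<Prod>b\<in>Basis. normal_density 0 (sqrt (1/2)) (x \<bullet> b)) * indicator (box l u) x
      = (\<Prod>b\<in>Basis. (\<lambda>y. ?n y * indicator {l \<bullet> b <..< u \<bullet> b} y) (x \<bullet> b))"
      by (simp add: prod.distrib prod_ennreal)
  qed
  also have "\<dots> = (\<Prod>b\<in>Basis. \<integral>\<^sup>+y. ?n y * indicator {l \<bullet> b <..< u \<bullet> b} y \<partial>lborel)"
    by (intro nn_integral_lborel_prod) auto
  finally show ?thesis by (simp add: emeasure_density normal_half_def)
qed

lemma prob_space_std_gauss: "prob_space (std_gauss :: 'e::euclidean_space measure)"
proof
  have "emeasure (std_gauss :: 'e measure) UNIV
      = (\<integral>\<^sup>+x. (\<Prod>b\<in>Basis. ennreal (normal_density 0 (sqrt (1/2)) ((x::'e) \<bullet> b))) \<partial>lborel)"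
    by (simp add: std_gauss_def emeasure_density prod_ennreal)
  also have "\<dots> = (\<Prod>b\<in>(Basis::'e set). \<integral>\<^sup>+y. ennreal (normal_density 0 (sqrt (1/2)) y) \<partial>lborel)"
    by (intro nn_integral_lborel_prod) auto
  also have "(\<integral>\<^sup>+y. ennreal (normal_density 0 (sqrt (1/2)) y) \<partial>lborel) = 1"
    by (subst nn_integral_eq_integral) auto
  finally show "emeasure (std_gauss :: 'e measure) (space std_gauss) = 1" by simp
qed

text \<open>Independence speaks about products of events, hence about boxes; these form an
  intersection-stable generator, so they determine the law. Used once for the two parts of a complex
  entry and once for the entries of the channel.\<close>

lemma eq_std_gaussI:
  fixes \<mu> :: "'e::euclidean_space measure"
  assumes box: "\<And>l u. emeasure \<mu> (box l u) = (\<Prod>b\<in>Basis. emeasure normal_half {l \<bullet> b <..< u \<bullet> b})"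
    and sets: "sets \<mu> = sets borel"
  shows "\<mu> = std_gauss"
proof (rule measure_eqI_generator_eq)
  let ?E = "range (\<lambda>(a, b). box a b::'e set)"
  interpret G: prob_space "std_gauss :: 'e measure" by (rule prob_space_std_gauss)
  show "Int_stable ?E"
    by (auto simp: Int_stable_def box_Int_box)
  show "?E \<subseteq> Pow UNIV" "sets \<mu> = sigma_sets UNIV ?E" "sets std_gauss = sigma_sets UNIV ?E"
    by (simp_all add: borel_eq_box sets)
  show "range (\<lambda>n::nat. box (- real n *\<^sub>R One) (real n *\<^sub>R One) :: 'e set) \<subseteq> ?E"
    by auto
  show "(\<Union>n::nat. box (- real n *\<^sub>R One) (real n *\<^sub>R One)) = (UNIV :: 'e set)"
    using UN_box_eq_UNIV by auto
  show "emeasure \<mu> X = emeasure std_gauss X" if "X \<in> ?E" for X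
    using that unfolding image_iff by (auto simp: box emeasure_std_gauss_box simp del: infinity_ennreal_def)
  show "emeasure \<mu> (box (- real n *\<^sub>R One) (real n *\<^sub>R One) :: 'e set) \<noteq> \<infinity>" for n :: nat
    unfolding box emeasure_std_gauss_box[symmetric] by (simp add: G.emeasure_finite)
qed

lemma distributed_normal_half_emeasure:
  assumes "distributed M lborel X (normal_density 0 (sqrt (1/2)))" "A \<in> sets borel"
  shows "emeasure normal_half A = emeasure M (X -` A \<inter> space M)"
proof -
  have "normal_half = distr M lborel X"
    using distributed_distr_eq_density[OF assms(1)] by (simp add: normal_half_def)
  moreover have "emeasure (distr M lborel X) A = emeasure M (X -` A \<inter> space M)"
    using assms(2) distributed_measurable[OF assms(1)] by (simp add: emeasure_distr)
  ultimately show ?thesis by simp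
qed

lemma (in prob_space) std_complex_gaussian_measurable:
  assumes "std_complex_gaussian M Z"
  shows "Z \<in> borel_measurable M"
proof -
  have "(\<lambda>\<omega>. Re (Z \<omega>)) \<in> borel_measurable M" "(\<lambda>\<omega>. Im (Z \<omega>)) \<in> borel_measurable M"
    using assms by (auto simp: std_complex_gaussian_def dest!: distributed_measurable)
  then show ?thesis by (simp add: borel_measurable_complex_iff)
qed

lemma (in prob_space) distr_std_complex_gaussian:
  assumes Z: "std_complex_gaussian M Z"
  shows "distr M borel Z = std_gauss"
proof (rule eq_std_gaussI)
  fix l u :: complex
  let ?R = "{Re l <..< Re u}" and ?I = "{Im l <..< Im u}"
  have [measurable]: "Z \<in> borel_measurable M"
    by (rule std_complex_gaussian_measurable[OF Z])
  have ind: "indep_var borel (\<lambda>\<omega>. Re (Z \<omega>)) borel (\<lambda>\<omega>. Im (Z \<omega>))"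
    and dRe: "distributed M lborel (\<lambda>\<omega>. Re (Z \<omega>)) (normal_density 0 (sqrt (1/2)))"
    and dIm: "distributed M lborel (\<lambda>\<omega>. Im (Z \<omega>)) (normal_density 0 (sqrt (1/2)))"
    using Z by (auto simp: std_complex_gaussian_def)
  have "emeasure (distr M borel Z) (box l u) = emeasure M (Z -` box l u \<inter> space M)"
    by (simp add: emeasure_distr)
  also have "Z -` box l u \<inter> space M = (\<lambda>\<omega>. (Re (Z \<omega>), Im (Z \<omega>))) -` (?R \<times> ?I) \<inter> space M"
    by (auto simp: box_def Basis_complex_def)
  also have "emeasure M \<dots> = ennreal (prob ((\<lambda>\<omega>. Re (Z \<omega>)) -` ?R \<inter> space M) * prob ((\<lambda>\<omega>. Im (Z \<omega>)) -` ?I \<inter> space M))"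
    using indep_varD[OF ind, of ?R ?I] by (simp add: emeasure_eq_measure)
  also have "\<dots> = emeasure normal_half ?R * emeasure normal_half ?I"
    using distributed_normal_half_emeasure[OF dRe, of ?R] distributed_normal_half_emeasure[OF dIm, of ?I]
    by (simp add: ennreal_mult emeasure_eq_measure)
  also have "\<dots> = (\<Prod>b\<in>Basis. emeasure normal_half {l \<bullet> b<..<u \<bullet> b})"
    by (simp add: Basis_complex_def)
  finally show "emeasure (distr M borel Z) (box l u) = (\<Prod>b\<in>Basis. emeasure normal_half {l \<bullet> b<..<u \<bullet> b})" .
qed simp

lemma Basis_vec_vec:
  "(Basis :: ('a::euclidean_space ^ 'nt ^ 'nr) set) = (\<lambda>((r, j), b). axis r (axis j b)) ` (UNIV \<times> Basis)"
  unfolding Basis_vec_def by (auto simp: image_iff) blast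

lemma inj_axis_axis: "inj_on (\<lambda>((r, j), b). axis r (axis j b) :: 'a::euclidean_space ^ 'nt ^ 'nr) (UNIV \<times> Basis)"
  by (auto simp: inj_on_def axis_eq_axis axis_eq_0_iff nonzero_Basis)

lemma inner_axis_axis: "x \<bullet> axis r (axis j b) = x $ r $ j \<bullet> b"
  by (simp add: inner_axis)

lemma mem_box_vec_vec:
  fixes l u x :: "'a::euclidean_space ^ 'nt ^ 'nr"
  shows "x \<in> box l u \<longleftrightarrow> (\<forall>r j. x $ r $ j \<in> box (l $ r $ j) (u $ r $ j))"
  by (auto simp: mem_box Basis_vec_vec inner_axis_axis)

lemma (in prob_space) distr_iid_gaussian_channel:
  fixes H :: "'a \<Rightarrow> complex ^ 'nt ^ 'nr"
  assumes H: "iid_gaussian_channel M H" and [measurable]: "H \<in> borel_measurable M"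
  shows "distr M borel H = std_gauss"
proof (rule eq_std_gaussI)
  fix l u :: "complex ^ 'nt ^ 'nr"
  let ?X = "\<lambda>(r, j) \<omega>. H \<omega> $ r $ j" and ?A = "\<lambda>(r, j). box (l $ r $ j) (u $ r $ j)"
  have ind: "indep_vars (\<lambda>_. borel) ?X UNIV" and Z: "\<And>r j. std_complex_gaussian M (\<lambda>\<omega>. H \<omega> $ r $ j)"
    using H by (auto simp: iid_gaussian_channel_def)
  have "emeasure (distr M borel H) (box l u) = emeasure M (H -` box l u \<inter> space M)"
    by (simp add: emeasure_distr)
  also have "H -` box l u \<inter> space M = (\<Inter>i\<in>UNIV. ?X i -` ?A i \<inter> space M)"
    by (auto simp: mem_box_vec_vec)
  also have "emeasure M \<dots> = ennreal (\<Prod>i\<in>UNIV. prob (?X i -` ?A i \<inter> space M))"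
    unfolding emeasure_eq_measure
    by (subst indep_varsD_finite[OF ind]) auto
  also have "\<dots> = (\<Prod>i\<in>UNIV. emeasure M (?X i -` ?A i \<inter> space M))"
    by (simp add: prod_ennreal emeasure_eq_measure)
  also have "\<dots> = (\<Prod>i\<in>UNIV. emeasure std_gauss (?A i))"
  proof (rule prod.cong[OF refl])
    fix i :: "'nr \<times> 'nt"
    obtain r j where i: "i = (r, j)" by (cases i)
    have "emeasure std_gauss (?A i) = emeasure (distr M borel (\<lambda>\<omega>. H \<omega> $ r $ j)) (?A i)"
      using distr_std_complex_gaussian[OF Z] by simp
    also have "\<dots> = emeasure M (?X i -` ?A i \<inter> space M)"
      using std_complex_gaussian_measurable[OF Z] by (simp add: emeasure_distr i)
    finally show "emeasure M (?X i -` ?A i \<inter> space M) = emeasure std_gauss (?A i)" by simp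
  qed
  also have "\<dots> = (\<Prod>i\<in>UNIV. \<Prod>b\<in>Basis. case (i, b) of ((r, j), b) \<Rightarrow> emeasure normal_half {l $ r $ j \<bullet> b<..<u $ r $ j \<bullet> b})"
    by (intro prod.cong refl) (auto simp: emeasure_std_gauss_box)
  also have "\<dots> = (\<Prod>x\<in>UNIV \<times> Basis. case x of ((r, j), b) \<Rightarrow> emeasure normal_half {l $ r $ j \<bullet> b<..<u $ r $ j \<bullet> b})"
    by (subst prod.cartesian_product) (intro prod.cong refl, auto)
  also have "\<dots> = (\<Prod>b\<in>Basis. emeasure normal_half {l \<bullet> b<..<u \<bullet> b})"
    unfolding Basis_vec_vec by (subst prod.reindex[OF inj_axis_axis]) (intro prod.cong refl, auto simp: inner_axis_axis)
  finally show "emeasure (distr M borel H) (box l u) = (\<Prod>b\<in>Basis. emeasure normal_half {l \<bullet> b<..<u \<bullet> b})" .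
qed simp

section \<open>The squared modulus of a complex Gaussian is exponential\<close>

lemma nn_integral_exp_tail:
  "(\<integral>\<^sup>+v. ennreal (exp (- v)) * indicator {s..} v \<partial>lborel) = ennreal (exp (- s))"
proof -
  have "(\<integral>\<^sup>+v. ennreal (exp (- v)) * indicator {s..} v \<partial>lborel)
      = (\<integral>\<^sup>+v. ennreal (exp (- (s + v))) * indicator {s..} (s + v) \<partial>lborel)"
    by (rule nn_integral_lborel_translation[symmetric]) measurable
  \<comment> \<open>The factor \<open>v ^ 0\<close> puts the integrand into the shape of the Gamma
    integral.\<close>
  also have "\<dots> = (\<integral>\<^sup>+v. ennreal (exp (- s)) * (ennreal (v ^ 0 * exp (- v)) * indicator {0..} v) \<partial>lborel)"
    by (intro nn_integral_cong) (auto simp: indicator_def exp_add[symmetric] ennreal_mult[symmetric])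
  also have "\<dots> = ennreal (exp (- s))"
    by (subst nn_integral_cmult) (auto simp: nn_intergal_power_times_exp_Ici simp del: power_0)
  finally show ?thesis .
qed

text \<open>Writing \<open>exp (- s)\<close> as the integral of \<open>exp (- v)\<close> over \<open>v \<ge> s\<close> reduces the claim to the area of an annulus.\<close>

lemma std_gauss_norm_sq_gt:
  assumes "0 \<le> a"
  shows "emeasure (std_gauss :: complex measure) {z. a < (cmod z)\<^sup>2} = ennreal (exp (- a))"
proof -
  have "emeasure (std_gauss :: complex measure) {z. a < (cmod z)\<^sup>2}
      = (\<integral>\<^sup>+z. ennreal (exp (- (cmod z)\<^sup>2) / pi) * indicator {z. a < (cmod z)\<^sup>2} z \<partial>lborel)"
    by (simp add: std_gauss_eq emeasure_density)
  also have "\<dots> = (\<integral>\<^sup>+z. \<integral>\<^sup>+v. ennreal (exp (- v) / pi) * indicator {z. a < (cmod z)\<^sup>2 \<and> (cmod z)\<^sup>2 \<le> v} z \<partial>lborel \<partial>lborel)"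
  proof (intro nn_integral_cong)
    fix z :: complex
    have "(\<integral>\<^sup>+v. ennreal (exp (- v) / pi) * indicator {z. a < (cmod z)\<^sup>2 \<and> (cmod z)\<^sup>2 \<le> v} z \<partial>lborel)
      = (\<integral>\<^sup>+v. (ennreal (1 / pi) * indicator {z. a < (cmod z)\<^sup>2} z) * (ennreal (exp (- v)) * indicator {(cmod z)\<^sup>2..} v) \<partial>lborel)"
      by (intro nn_integral_cong) (auto simp: indicator_def ennreal_mult[symmetric])
    also have "\<dots> = (ennreal (1 / pi) * indicator {z. a < (cmod z)\<^sup>2} z) * ennreal (exp (- (cmod z)\<^sup>2))"
      by (subst nn_integral_cmult) (auto simp: nn_integral_exp_tail)
    finally show "ennreal (exp (- (cmod z)\<^sup>2) / pi) * indicator {z. a < (cmod z)\<^sup>2} z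
      = (\<integral>\<^sup>+v. ennreal (exp (- v) / pi) * indicator {z. a < (cmod z)\<^sup>2 \<and> (cmod z)\<^sup>2 \<le> v} z \<partial>lborel)"
      by (auto simp: indicator_def ennreal_mult[symmetric])
  qed
  also have "\<dots> = (\<integral>\<^sup>+v. \<integral>\<^sup>+z. ennreal (exp (- v) / pi) * indicator {z. a < (cmod z)\<^sup>2 \<and> (cmod z)\<^sup>2 \<le> v} z \<partial>lborel \<partial>lborel)"
    by (rule lborel_pair.Fubini') (simp add: indicator_def, measurable)
  also have "\<dots> = (\<integral>\<^sup>+v. ennreal (exp (- v) * (v - a)) * indicator {a..} v \<partial>lborel)"
  proof (intro nn_integral_cong)
    fix v :: real
    let ?S = "{z::complex. a < (cmod z)\<^sup>2 \<and> (cmod z)\<^sup>2 \<le> v}"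
    have "(\<integral>\<^sup>+z. ennreal (exp (- v) / pi) * indicator ?S z \<partial>lborel) = ennreal (exp (- v) / pi) * emeasure lborel ?S"
      by (subst nn_integral_cmult_indicator) auto
    also have "\<dots> = ennreal (exp (- v) * (v - a)) * indicator {a..} v"
    proof (cases "a \<le> v")
      case True
      have S: "?S = cball 0 (sqrt v) - cball 0 (sqrt a)"
      proof -
        have "(cmod z)\<^sup>2 \<le> t \<longleftrightarrow> cmod z \<le> sqrt t" for z t
          by (metis abs_norm_cancel real_sqrt_abs real_sqrt_le_iff)
        from this[of _ v] this[of _ a] show ?thesis by (auto simp: not_le[symmetric])
      qed
      have "emeasure lborel ?S = ennreal (pi * v) - ennreal (pi * a)"
        unfolding S using assms True
        by (subst emeasure_Diff) (auto simp: emeasure_cball unit_ball_vol_2 intro: order_trans[OF _ real_sqrt_le_mono])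
      also have "\<dots> = ennreal (pi * (v - a))"
        using assms True by (subst ennreal_minus) (auto simp: algebra_simps)
      finally show ?thesis
        using True by (simp add: ennreal_mult[symmetric])
    next
      case False
      then have "?S = {}" by auto
      then have "emeasure lborel ?S = 0" by (simp only: emeasure_empty)
      then show ?thesis using False by simp
    qed
    finally show "(\<integral>\<^sup>+z. ennreal (exp (- v) / pi) * indicator ?S z \<partial>lborel) = ennreal (exp (- v) * (v - a)) * indicator {a..} v" .
  qed
  also have "\<dots> = (\<integral>\<^sup>+v. ennreal (exp (- (a + v)) * (a + v - a)) * indicator {a..} (a + v) \<partial>lborel)"
    by (rule nn_integral_lborel_translation[symmetric]) measurable
  also have "\<dots> = (\<integral>\<^sup>+v. ennreal (exp (- a)) * (ennreal (v ^ 1 * exp (- v)) * indicator {0..} v) \<partial>lborel)"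
    by (intro nn_integral_cong) (auto simp: indicator_def exp_diff exp_minus field_simps ennreal_mult[symmetric])
  also have "\<dots> = ennreal (exp (- a))"
    using nn_intergal_power_times_exp_Ici[of 1] by (subst nn_integral_cmult) auto
  finally show ?thesis .
qed

abbreviation exp1 :: "real measure" where
  "exp1 \<equiv> density lborel (\<lambda>x. ennreal (exponential_density 1 x))"

lemma distr_std_gauss_norm_sq:
  "distr (std_gauss :: complex measure) borel (\<lambda>z. (cmod z)\<^sup>2) = exp1"
proof -
  interpret G: prob_space "std_gauss :: complex measure" by (rule prob_space_std_gauss)
  have "distributed (std_gauss :: complex measure) lborel (\<lambda>z. (cmod z)\<^sup>2) (exponential_density 1)"
  proof (rule exponential_distributedI)
    fix a :: real assume a: "0 \<le> a"
    have "{z \<in> space std_gauss. (cmod z)\<^sup>2 \<le> a} = space std_gauss - {z. a < (cmod z)\<^sup>2}" by auto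
    then have "emeasure std_gauss {z \<in> space std_gauss. (cmod z)\<^sup>2 \<le> a} = 1 - ennreal (exp (- a))"
      using emeasure_compl[of "{z. a < (cmod z)\<^sup>2}" std_gauss] std_gauss_norm_sq_gt[OF a] G.emeasure_space_1 by simp
    then show "emeasure std_gauss {z \<in> space std_gauss. (cmod z)\<^sup>2 \<le> a} = 1 - ennreal (exp (- a * 1))"
      by simp
  qed auto
  from distributed_distr_eq_density[OF this] show ?thesis by (simp cong: distr_cong)
qed

section \<open>Reduction to independent exponential gains\<close>

text \<open>Coverage at a single antenna: \<open>x n\<close> is the squared gain of the \<open>n\<close>th beam and \<open>c\<close> is the noise \<open>N / \<rho>\<close>.\<close>

definition covered :: "nat \<Rightarrow> real \<Rightarrow> real \<Rightarrow> (nat \<Rightarrow> real) \<Rightarrow> bool" where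
  "covered N c T x \<longleftrightarrow> (\<exists>n\<in>{1..N}. T * (c + (\<Sum>i\<in>{1..N} - {n}. x i)) < x n)"

lemma covered_cong: "(\<And>n. n \<in> {1..N} \<Longrightarrow> x n = y n) \<Longrightarrow> covered N c T x = covered N c T y"
  unfolding covered_def by (intro bex_cong refl) (auto intro!: arg_cong2[where f="(<)"] sum.cong)

lemma measurable_covered[measurable (raw)]:
  assumes [measurable]: "\<And>n. n \<in> {1..N} \<Longrightarrow> (\<lambda>z. x z n) \<in> borel_measurable K"
  shows "Measurable.pred K (\<lambda>z. covered N c T (x z))"
  unfolding covered_def by measurable

lemma Max_sinr_gt_iff:
  fixes h :: "complex ^ 'nt ^ 'nr"
  assumes "1 \<le> N" "0 < \<rho>"
  shows "(MAX (n, r) \<in> {1..N} \<times> UNIV. sinr N \<rho> h f n r) > T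
    \<longleftrightarrow> (\<exists>r. covered N (real N / \<rho>) T (\<lambda>n. (cmod ((h *v f n) $ r))\<^sup>2))"
proof -
  have "0 < real N / \<rho> + (\<Sum>i\<in>{1..N} - {n}. (cmod ((h *v f i) $ r))\<^sup>2)" for n r
    using assms by (intro add_pos_nonneg sum_nonneg) auto
  then have "T < sinr N \<rho> h f n r \<longleftrightarrow>
      T * (real N / \<rho> + (\<Sum>i\<in>{1..N} - {n}. (cmod ((h *v f i) $ r))\<^sup>2)) < (cmod ((h *v f n) $ r))\<^sup>2" for n r
    by (simp add: sinr_def pos_less_divide_eq)
  then show ?thesis
    using assms by (subst Max_gr_iff) (auto simp: covered_def)
qed

lemma distr_pair_indep_rvs:
  assumes "prob_space M" and ind: "indep_rvs M A X B Y"
  shows "distr M (A \<Otimes>\<^sub>M B) (\<lambda>\<omega>. (X \<omega>, Y \<omega>)) = distr M A X \<Otimes>\<^sub>M distr M B Y"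
proof (rule pair_measure_eqI[symmetric])
  interpret prob_space M by fact
  have [measurable]: "X \<in> measurable M A" "Y \<in> measurable M B"
    using ind by (auto simp: indep_rvs_def)
  interpret X: prob_space "distr M A X" by (rule prob_space_distr) measurable
  interpret Y: prob_space "distr M B Y" by (rule prob_space_distr) measurable
  show "sigma_finite_measure (distr M A X)" "sigma_finite_measure (distr M B Y)" ..
  fix S R assume "S \<in> sets (distr M A X)" "R \<in> sets (distr M B Y)"
  then have [measurable]: "S \<in> sets A" "R \<in> sets B" by auto
  have "prob ((X -` S \<inter> space M) \<inter> (Y -` R \<inter> space M)) = prob (X -` S \<inter> space M) * prob (Y -` R \<inter> space M)"
    using ind by (intro indep_setD) (auto simp: indep_rvs_def)
  moreover have "(\<lambda>\<omega>. (X \<omega>, Y \<omega>)) -` (S \<times> R) \<inter> space M = (X -` S \<inter> space M) \<inter> (Y -` R \<inter> space M)"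
    by auto
  ultimately show "emeasure (distr M A X) S * emeasure (distr M B Y) R
      = emeasure (distr M (A \<Otimes>\<^sub>M B) (\<lambda>\<omega>. (X \<omega>, Y \<omega>))) (S \<times> R)"
    by (simp add: emeasure_distr emeasure_eq_measure ennreal_mult)
qed simp

text \<open>The row-wise map sends the conjugated beams, seen as a real orthonormal family together with their
  multiples by \<open>\<i>\<close>, to coordinate axes.\<close>

lemma unitary_row_map:
  fixes f :: "nat \<Rightarrow> complex ^ 'nt" and \<iota> :: "nat \<Rightarrow> 'nt"
  assumes f: "orthonormal_family N f" and \<iota>: "inj_on \<iota> {1..N}"
  obtains U :: "complex ^ 'nt ^ 'nr \<Rightarrow> complex ^ 'nt ^ 'nr" where
    "linear U" "\<And>h. norm (U h) = norm h" "\<And>h r n. n \<in> {1..N} \<Longrightarrow> U h $ r $ \<iota> n = (h *v f n) $ r"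
proof -
  define e where "e s = (if s then \<i> else 1)" for s
  \<comment> \<open>The channel meets the beams without conjugation. Against the conjugated beam,
    the real inner product gives the real part of that product for \<open>s = False\<close> and its
    imaginary part for \<open>s = True\<close>.\<close>
  define a where "a = (\<lambda>(n, s). \<chi> j. cnj (f n $ j) * e s)"
  define b where "b = (\<lambda>(n, s). axis (\<iota> n) (e s) :: complex ^ 'nt)"
  let ?K = "{1..N} \<times> (UNIV :: bool set)"
  have inner_v: "x \<bullet> y = Re (\<Sum>j\<in>UNIV. cnj (x $ j) * y $ j)" for x y :: "complex ^ 'nt"
    by (simp add: inner_vec_def inner_complex_def)
  have aa: "a k \<bullet> a l = (if k = l then 1 else 0)" if kl: "k \<in> ?K" "l \<in> ?K" for k l
  proof -
    obtain n s m t where k: "k = (n, s)" and l: "l = (m, t)" by (cases k, cases l)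
    have "(\<Sum>j\<in>UNIV. cnj (a k $ j) * a l $ j) = (\<Sum>j\<in>UNIV. (cnj (e s) * e t) * (cnj (f m $ j) * f n $ j))"
      by (intro sum.cong refl) (simp add: a_def k l mult.commute mult.left_commute)
    then have "a k \<bullet> a l = Re (cnj (e s) * e t * hermitian_inner (f m) (f n))"
      unfolding inner_v hermitian_inner_def sum_distrib_left by (rule arg_cong)
    also have "hermitian_inner (f m) (f n) = (if m = n then 1 else 0)"
      using f kl by (auto simp: orthonormal_family_def k l)
    also have "Re (cnj (e s) * e t * (if m = n then 1 else 0)) = (if k = l then 1 else 0)"
      by (cases s; cases t; cases "m = n"; simp add: k l e_def)
    finally show ?thesis .
  qed
  have bb: "b k \<bullet> b l = (if k = l then 1 else 0)" if kl: "k \<in> ?K" "l \<in> ?K" for k l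
  proof -
    obtain n s m t where k: "k = (n, s)" and l: "l = (m, t)" by (cases k, cases l)
    have "b k \<bullet> b l = axis (\<iota> n) (e s) $ \<iota> m \<bullet> e t"
      unfolding b_def k l prod.case inner_axis ..
    also have "axis (\<iota> n) (e s) $ \<iota> m = (if \<iota> m = \<iota> n then e s else 0)"
      by (simp add: axis_def)
    also have "\<iota> m = \<iota> n \<longleftrightarrow> n = m"
      using kl inj_on_eq_iff[OF \<iota>, of m n] by (auto simp: k l)
    also have "(if n = m then e s else 0) \<bullet> e t = (if k = l then 1 else 0)"
      by (cases s; cases t; cases "n = m") (simp_all add: k l e_def inner_complex_def)
    finally show ?thesis .
  qed
  have "\<exists>V. linear V \<and> (\<forall>x y. V x \<bullet> V y = x \<bullet> y) \<and> (\<forall>k\<in>?K. V (a k) = b k)"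
    by (rule linear_isometry_orthonormal_family[of ?K a b]) (simp_all add: aa bb del: One_nat_def)
  then obtain V where V: "linear V" "\<And>x y. V x \<bullet> V y = x \<bullet> y" "\<And>k. k \<in> ?K \<Longrightarrow> V (a k) = b k"
    by blast
  have Vi: "V v $ \<iota> n = (\<Sum>j\<in>UNIV. v $ j * f n $ j)" if n: "n \<in> {1..N}" for v n
  proof (rule complex_eqI)
    let ?S = "\<Sum>j\<in>UNIV. v $ j * f n $ j"
    have vb: "V v \<bullet> b (n, s) = Re (cnj ?S * e s)" for s
    proof -
      have "(\<Sum>j\<in>UNIV. cnj (v $ j) * a (n, s) $ j) = cnj ?S * e s"
        unfolding cnj_sum sum_distrib_right by (intro sum.cong refl) (simp add: a_def)
      then have "v \<bullet> a (n, s) = Re (cnj ?S * e s)"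
        unfolding inner_v by (rule arg_cong)
      then show ?thesis
        using V(2)[of v "a (n, s)"] V(3)[of "(n, s)"] n by simp
    qed
    have "Re (V v $ \<iota> n) = V v \<bullet> b (n, False)" "Im (V v $ \<iota> n) = V v \<bullet> b (n, True)"
      by (simp_all add: b_def e_def inner_axis inner_complex_def)
    then show "Re (V v $ \<iota> n) = Re ?S" "Im (V v $ \<iota> n) = Im ?S"
      unfolding vb by (simp_all add: e_def del: cnj_sum Re_sum Im_sum)
  qed
  have normV: "norm (V x) = norm x" for x unfolding norm_eq_sqrt_inner V(2) ..
  show thesis
  proof (rule that[of "\<lambda>h. \<chi> r. V (h $ r)"])
    show "linear (\<lambda>h::complex ^ 'nt ^ 'nr. \<chi> r. V (h $ r))"
      by (rule linearI) (auto simp: vec_eq_iff linear_add[OF V(1)] linear_cmul[OF V(1)])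
    show "norm (\<chi> r. V (h $ r)) = norm h" for h :: "complex ^ 'nt ^ 'nr"
      unfolding norm_vec_def[where 'b='nr] by (simp add: normV)
    show "(\<chi> r. V (h $ r)) $ r $ \<iota> n = (h *v f n) $ r" if "n \<in> {1..N}" for h :: "complex ^ 'nt ^ 'nr" and r n
      using Vi[OF that] by (simp add: matrix_vector_mult_def)
  qed
qed

lemma borel_measurable_vec_nth2[measurable (raw)]:
  fixes g :: "'a \<Rightarrow> complex ^ 'nt ^ 'nr"
  assumes [measurable]: "g \<in> borel_measurable K"
  shows "(\<lambda>x. g x $ r $ j) \<in> borel_measurable K"
  by (rule borel_measurable_continuous_on[OF _ assms]) (intro continuous_intros)

lemma borel_measurable_vec_nth1[measurable (raw)]:
  fixes g :: "'a \<Rightarrow> complex ^ 'nt"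
  assumes [measurable]: "g \<in> borel_measurable K"
  shows "(\<lambda>x. g x $ j) \<in> borel_measurable K"
  by (rule borel_measurable_continuous_on[OF _ assms]) (intro continuous_intros)

text \<open>Independence makes the joint law of channel and beams a product. For each orthonormal
  choice of beams an isometry moves their products with the rows onto fixed coordinates without
  changing the channel law, so the conditional coverage probability is the same constant almost
  surely and equals its average.\<close>

lemma coverage_AS_eq_axes:
  fixes H :: "'a \<Rightarrow> complex ^ 'nt ^ 'nr" and \<phi> :: "nat \<Rightarrow> 'a \<Rightarrow> complex ^ 'nt"
  assumes "prob_space M" "1 \<le> N" "0 < \<rho>"
    and H: "iid_gaussian_channel M H"
    and orth: "AE \<omega> in M. orthonormal_family N (\<lambda>n. \<phi> n \<omega>)"
    and ind: "indep_rvs M borel H (\<Pi>\<^sub>M n\<in>{1..N}. borel) (\<lambda>\<omega>. \<lambda>n\<in>{1..N}. \<phi> n \<omega>)"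
    and \<iota>: "inj_on \<iota> {1..N}"
  shows "coverage_AS M N \<rho> T H \<phi> =
    measure M {\<omega> \<in> space M. \<exists>r. covered N (real N / \<rho>) T (\<lambda>n. (cmod (H \<omega> $ r $ \<iota> n))\<^sup>2)}"
proof -
  note One_nat_def[simp del]
  interpret prob_space M by fact
  let ?P = "\<Pi>\<^sub>M n\<in>{1..N}. (borel :: (complex ^ 'nt) measure)"
  let ?\<phi> = "\<lambda>\<omega>. \<lambda>n\<in>{1..N}. \<phi> n \<omega>"
  have [measurable]: "H \<in> borel_measurable M" "?\<phi> \<in> measurable M ?P"
    using ind by (auto simp: indep_rvs_def)
  define G where "G h f \<longleftrightarrow> (\<exists>r. covered N (real N / \<rho>) T (\<lambda>n. (cmod ((h *v f n) $ r))\<^sup>2))"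
    for h :: "complex ^ 'nt ^ 'nr" and f
  define G0 where "G0 h \<longleftrightarrow> (\<exists>r. covered N (real N / \<rho>) T (\<lambda>n. (cmod (h $ r $ \<iota> n))\<^sup>2))"
    for h :: "complex ^ 'nt ^ 'nr"
  have [measurable]: "Measurable.pred (borel \<Otimes>\<^sub>M ?P) (\<lambda>z. G (fst z) (snd z))"
    unfolding G_def matrix_vector_mult_def by (simp, measurable)
  \<comment> \<open>The swapped order serves the measurability of the conditional probability in the
    beams, whose sections fix the first component of a pair.\<close>
  have [measurable]: "Measurable.pred (?P \<Otimes>\<^sub>M borel) (\<lambda>z. G (snd z) (fst z))"
    unfolding G_def matrix_vector_mult_def by (simp, measurable)
  have [measurable]: "Measurable.pred borel G0"
    unfolding G0_def by measurable
  have const: "emeasure std_gauss {h. G h f} = emeasure M {\<omega> \<in> space M. G0 (H \<omega>)}"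
    if f: "orthonormal_family N f" and [measurable]: "Measurable.pred borel (\<lambda>h. G h f)" for f
  proof -
    obtain U :: "complex ^ 'nt ^ 'nr \<Rightarrow> complex ^ 'nt ^ 'nr" where
      U: "linear U" "\<And>h. norm (U h) = norm h" "\<And>h r n. n \<in> {1..N} \<Longrightarrow> U h $ r $ \<iota> n = (h *v f n) $ r"
      using unitary_row_map[OF f \<iota>] by blast
    have [measurable]: "U \<in> borel_measurable borel"
      using U(1) by (intro borel_measurable_continuous_onI linear_continuous_on linear_conv_bounded_linear[THEN iffD1])
    have "G h f = G0 (U h)" for h
      unfolding G_def G0_def by (intro arg_cong[where f=Ex] ext covered_cong) (simp add: U(3))
    then have "{h. G h f} = U -` {h. G0 h}" by auto
    then have "emeasure std_gauss {h. G h f} = emeasure (distr std_gauss borel U) {h. G0 h}"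
      by (subst emeasure_distr) auto
    also have "distr std_gauss borel U = distr M borel H"
      using U by (simp add: std_gauss_distr_linear_isometry distr_iid_gaussian_channel[OF H])
    also have "emeasure (distr M borel H) {h. G0 h} = emeasure M {\<omega> \<in> space M. G0 (H \<omega>)}"
      by (subst emeasure_distr) (auto intro!: arg_cong[where f="emeasure M"])
    finally show ?thesis .
  qed
  \<comment> \<open>Only the beams \<open>1..N\<close> are read, so \<open>\<phi>\<close> may be
    replaced by its restriction, the random variable about which the independence hypothesis
    speaks.\<close>
  have "{\<omega> \<in> space M. (MAX (n, r) \<in> {1..N} \<times> UNIV. sinr N \<rho> (H \<omega>) (\<lambda>i. \<phi> i \<omega>) n r) > T}
      = {\<omega> \<in> space M. G (H \<omega>) (?\<phi> \<omega>)}"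
    unfolding Max_sinr_gt_iff[OF \<open>1 \<le> N\<close> \<open>0 < \<rho>\<close>] G_def
    by (intro Collect_cong conj_cong refl arg_cong[where f=Ex] ext covered_cong) simp
  then have "emeasure M {\<omega> \<in> space M. (MAX (n, r) \<in> {1..N} \<times> UNIV. sinr N \<rho> (H \<omega>) (\<lambda>i. \<phi> i \<omega>) n r) > T}
      = emeasure M {\<omega> \<in> space M. G (H \<omega>) (?\<phi> \<omega>)}" by simp
  also have "\<dots> = emeasure (distr M (borel \<Otimes>\<^sub>M ?P) (\<lambda>\<omega>. (H \<omega>, ?\<phi> \<omega>))) {z \<in> space (borel \<Otimes>\<^sub>M ?P). G (fst z) (snd z)}"
    by (subst emeasure_distr) (auto simp: space_pair_measure space_PiM intro!: arg_cong[where f="emeasure M"])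
  also have "\<dots> = emeasure (std_gauss \<Otimes>\<^sub>M distr M ?P ?\<phi>) {z \<in> space (borel \<Otimes>\<^sub>M ?P). G (fst z) (snd z)}"
    by (simp add: distr_pair_indep_rvs[OF \<open>prob_space M\<close> ind] distr_iid_gaussian_channel[OF H])
  also have "\<dots> = (\<integral>\<^sup>+f. emeasure std_gauss {h. G h f} \<partial>distr M ?P ?\<phi>)"
  proof -
    interpret G: prob_space "std_gauss :: (complex ^ 'nt ^ 'nr) measure" by (rule prob_space_std_gauss)
    interpret P: prob_space "distr M ?P ?\<phi>" by (rule prob_space_distr) measurable
    interpret pair_sigma_finite "std_gauss :: (complex ^ 'nt ^ 'nr) measure" "distr M ?P ?\<phi>" ..
    have "{z \<in> space (borel \<Otimes>\<^sub>M ?P). G (fst z) (snd z)} \<in> sets (borel \<Otimes>\<^sub>M ?P)"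
      by measurable
    also have "sets (borel \<Otimes>\<^sub>M ?P) = sets (std_gauss \<Otimes>\<^sub>M distr M ?P ?\<phi>)"
      by (intro sets_pair_measure_cong) simp_all
    finally show ?thesis
      by (subst emeasure_pair_measure_alt2)
        (auto simp: space_pair_measure intro!: nn_integral_cong arg_cong[where f="emeasure std_gauss"])
  qed
  also have "\<dots> = (\<integral>\<^sup>+\<omega>. emeasure std_gauss {h. G h (?\<phi> \<omega>)} \<partial>M)"
  proof (rule nn_integral_distr)
    interpret G: prob_space "std_gauss :: (complex ^ 'nt ^ 'nr) measure" by (rule prob_space_std_gauss)
    have "(\<lambda>f. emeasure std_gauss (Pair f -` {z \<in> space (?P \<Otimes>\<^sub>M std_gauss). G (snd z) (fst z)})) \<in> borel_measurable ?P"
      by (intro G.measurable_emeasure_Pair) measurable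
    moreover have "Pair f -` {z \<in> space (?P \<Otimes>\<^sub>M std_gauss). G (snd z) (fst z)} = {h. G h f}" if "f \<in> space ?P" for f
      using that by (auto simp: space_pair_measure)
    ultimately have "(\<lambda>f. emeasure std_gauss {h. G h f}) \<in> borel_measurable ?P"
      by (simp cong: measurable_cong)
    then show "(\<lambda>f. emeasure std_gauss {h. G h f}) \<in> borel_measurable (distr M ?P ?\<phi>)"
      by (simp only: measurable_distr_eq1)
  qed measurable
  also have "\<dots> = (\<integral>\<^sup>+\<omega>. emeasure M {\<omega> \<in> space M. G0 (H \<omega>)} \<partial>M)"
  proof (rule nn_integral_cong_AE, use orth in eventually_elim)
    case (elim \<omega>)
    then have "orthonormal_family N (?\<phi> \<omega>)" by (auto simp: orthonormal_family_def)
    moreover have "Measurable.pred borel (\<lambda>h. G h (?\<phi> \<omega>))"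
      unfolding G_def matrix_vector_mult_def by (simp, measurable)
    ultimately show ?case by (rule const)
  qed
  also have "\<dots> = emeasure M {\<omega> \<in> space M. G0 (H \<omega>)}"
    by (simp add: emeasure_space_1)
  finally show ?thesis
    by (simp add: coverage_AS_def emeasure_eq_measure G0_def)
qed

section \<open>Independence of gains and antennas\<close>

lemma (in prob_space) indep_vars_reindex:
  assumes f: "inj_on f I" and X: "indep_vars M' X (f ` I)"
  shows "indep_vars (\<lambda>i. M' (f i)) (\<lambda>i. X (f i)) I"
  unfolding indep_vars_def
proof
  show "\<forall>i\<in>I. random_variable (M' (f i)) (X (f i))"
    using X by (auto simp: indep_vars_def)
  let ?F = "\<lambda>i. sigma_sets (space M) {X i -` A \<inter> space M |A. A \<in> sets (M' i)}"
  have F: "indep_sets ?F (f ` I)" using X by (simp add: indep_vars_def)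
  show "indep_sets (\<lambda>i. ?F (f i)) I"
  proof (rule indep_setsI)
    show "?F (f i) \<subseteq> events" if "i \<in> I" for i
      using F that by (auto simp: indep_sets_def)
    fix A J assume J: "J \<noteq> {}" "J \<subseteq> I" "finite J" "\<forall>j\<in>J. A j \<in> ?F (f j)"
    have inj: "inj_on f J" using f J(2) inj_on_subset by blast
    have inv: "the_inv_into J f (f j) = j" if "j \<in> J" for j
      using inj that by (rule the_inv_into_f_f)
    have "prob (\<Inter>j\<in>f ` J. A (the_inv_into J f j)) = (\<Prod>j\<in>f ` J. prob (A (the_inv_into J f j)))"
      using J inv by (intro indep_setsD[OF F]) auto
    then show "prob (\<Inter>j\<in>J. A j) = (\<Prod>j\<in>J. prob (A j))"
      by (simp add: prod.reindex[OF inj] inv cong: INF_cong_simp prod.cong_simp)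
  qed
qed

text \<open>Within a row, distinct entries make the squared gains independent exponentials, so every
  antenna has the same coverage probability \<open>p\<close>. The antennas read disjoint rows, hence
  all of them fail with probability \<open>(1 - p) ^ CARD('nr)\<close>.\<close>

lemma iid_gaussian_channel_coverage:
  fixes H :: "'a \<Rightarrow> complex ^ 'nt ^ 'nr"
  assumes "prob_space M" "1 \<le> N" and H: "iid_gaussian_channel M H" and \<iota>: "inj_on \<iota> {1..N}"
  shows "measure M {\<omega> \<in> space M. \<exists>r. covered N c T (\<lambda>n. (cmod (H \<omega> $ r $ \<iota> n))\<^sup>2)}
    = 1 - (1 - measure (\<Pi>\<^sub>M n\<in>{1..N}. exp1) {x \<in> space (\<Pi>\<^sub>M n\<in>{1..N}. exp1). covered N c T x}) ^ CARD('nr)"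
proof -
  note One_nat_def[simp del]
  interpret prob_space M by fact
  let ?B = "\<Pi>\<^sub>M n\<in>{1..N}. (borel :: real measure)"
  define Y where "Y = (\<lambda>(r, j) \<omega>. (cmod (H \<omega> $ r $ j))\<^sup>2)"
  have "indep_vars (\<lambda>_. borel) (\<lambda>(r, j) \<omega>. H \<omega> $ r $ j) (UNIV :: ('nr \<times> 'nt) set)"
    and Z: "std_complex_gaussian M (\<lambda>\<omega>. H \<omega> $ r $ j)" for r j
    using H by (auto simp: iid_gaussian_channel_def)
  then have "indep_vars (\<lambda>_. borel) (\<lambda>i \<omega>. (cmod ((case i of (r, j) \<Rightarrow> \<lambda>\<omega>. H \<omega> $ r $ j) \<omega>))\<^sup>2) (UNIV :: ('nr \<times> 'nt) set)"
    by (intro indep_vars_compose2[where Y="\<lambda>_ z. (cmod z)\<^sup>2"]) auto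
  then have indY: "indep_vars (\<lambda>_. borel) Y UNIV"
    by (simp add: Y_def case_prod_beta')
  have Zm[measurable]: "(\<lambda>\<omega>. H \<omega> $ r $ j) \<in> borel_measurable M" for r j
    by (rule std_complex_gaussian_measurable[OF Z])
  have Ym[measurable]: "Y i \<in> borel_measurable M" for i
    by (cases i) (simp add: Y_def)
  have distrY: "distr M borel (Y (r, j)) = exp1" for r j
  proof -
    have "distr M borel (Y (r, j)) = distr (distr M borel (\<lambda>\<omega>. H \<omega> $ r $ j)) borel (\<lambda>z. (cmod z)\<^sup>2)"
      by (subst distr_distr) (auto simp: Y_def comp_def)
    then show ?thesis
      by (simp add: distr_std_complex_gaussian[OF Z] distr_std_gauss_norm_sq)
  qed
  define p where "p = measure (\<Pi>\<^sub>M n\<in>{1..N}. exp1) {x \<in> space (\<Pi>\<^sub>M n\<in>{1..N}. exp1). covered N c T x}"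
  have row: "prob {\<omega> \<in> space M. covered N c T (\<lambda>n. Y (r, \<iota> n) \<omega>)} = p" for r
  proof -
    have "indep_vars (\<lambda>_. borel) Y ((\<lambda>n. (r, \<iota> n)) ` {1..N})"
      by (rule indep_vars_subset[OF indY]) simp
    moreover have "inj_on (\<lambda>n. (r, \<iota> n)) {1..N}"
    proof (rule inj_onI)
      fix x y assume "x \<in> {1..N}" "y \<in> {1..N}" "(r, \<iota> x) = (r, \<iota> y)"
      then show "x = y" using inj_on_eq_iff[OF \<iota>, of x y] by blast
    qed
    ultimately have "indep_vars (\<lambda>_. borel) (\<lambda>n. Y (r, \<iota> n)) {1..N}"
      using indep_vars_reindex[of "\<lambda>n. (r, \<iota> n)" "{1..N}" "\<lambda>_. borel" Y] by simp
    then have D: "distr M ?B (\<lambda>\<omega>. \<lambda>n\<in>{1..N}. Y (r, \<iota> n) \<omega>) = (\<Pi>\<^sub>M n\<in>{1..N}. exp1)"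
      using \<open>1 \<le> N\<close> by (subst (asm) indep_vars_iff_distr_eq_PiM') (auto simp: distrY)
    have "p = measure (distr M ?B (\<lambda>\<omega>. \<lambda>n\<in>{1..N}. Y (r, \<iota> n) \<omega>)) {x \<in> space ?B. covered N c T x}"
      unfolding D p_def by (simp add: space_PiM)
    also have "\<dots> = prob {\<omega> \<in> space M. covered N c T (\<lambda>n\<in>{1..N}. Y (r, \<iota> n) \<omega>)}"
      by (subst measure_distr) (auto simp: space_PiM intro!: arg_cong[where f="measure M"])
    also have "{\<omega> \<in> space M. covered N c T (\<lambda>n\<in>{1..N}. Y (r, \<iota> n) \<omega>)} = {\<omega> \<in> space M. covered N c T (\<lambda>n. Y (r, \<iota> n) \<omega>)}"
      by (intro Collect_cong conj_cong refl covered_cong) simp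
    finally show ?thesis by simp
  qed
  \<comment> \<open>One block of indices per antenna; disjoint blocks of an independent family are
    independent as whole vectors.\<close>
  let ?K = "\<lambda>r::'nr. {r} \<times> (UNIV :: 'nt set)"
  let ?X = "\<lambda>r \<omega>. restrict (\<lambda>i. Y i \<omega>) (?K r)"
  let ?A = "\<lambda>r. {x \<in> space (PiM (?K r) (\<lambda>_. borel)). \<not> covered N c T (\<lambda>n. x (r, \<iota> n))}"
  have indX: "indep_vars (\<lambda>r. PiM (?K r) (\<lambda>_. borel)) ?X UNIV"
    by (rule indep_vars_restrict[OF indY]) (auto simp: disjoint_family_on_def)
  have Ams: "?A r \<in> sets (PiM (?K r) (\<lambda>_. borel))" for r
    by measurable
  have XA: "?X r -` ?A r \<inter> space M = {\<omega> \<in> space M. \<not> covered N c T (\<lambda>n. Y (r, \<iota> n) \<omega>)}" for r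
    by (auto simp: space_PiM)
  have "prob {\<omega> \<in> space M. \<not> (\<exists>r. covered N c T (\<lambda>n. Y (r, \<iota> n) \<omega>))} = prob (\<Inter>r\<in>UNIV. ?X r -` ?A r \<inter> space M)"
    unfolding XA by (intro arg_cong[where f=prob]) auto
  also have "\<dots> = (\<Prod>r\<in>UNIV. prob (?X r -` ?A r \<inter> space M))"
    using Ams by (intro indep_varsD_finite[OF indX]) auto
  also have "\<dots> = (\<Prod>r\<in>(UNIV :: 'nr set). 1 - p)"
    unfolding XA by (intro prod.cong refl) (subst prob_neg, measurable, simp add: row)
  finally have "prob {\<omega> \<in> space M. \<not> (\<exists>r. covered N c T (\<lambda>n. Y (r, \<iota> n) \<omega>))} = (1 - p) ^ CARD('nr)"
    by simp
  moreover have "{\<omega> \<in> space M. \<exists>r. covered N c T (\<lambda>n. Y (r, \<iota> n) \<omega>)} \<in> events"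
    by measurable
  ultimately have "1 - prob {\<omega> \<in> space M. \<exists>r. covered N c T (\<lambda>n. Y (r, \<iota> n) \<omega>)} = (1 - p) ^ CARD('nr)"
    using prob_neg[of "\<lambda>\<omega>. \<exists>r. covered N c T (\<lambda>n. Y (r, \<iota> n) \<omega>)"] by argo
  then show ?thesis
    by (simp add: Y_def p_def)
qed

section \<open>Sums of truncated exponentials\<close>

text \<open>A truncated power. Because \<open>0 ^ 0 = 1\<close>, \<open>pospow 0\<close> is the
  indicator of the closed half-line, and for \<open>x \<ge> 0\<close> the difference in
  \<open>spline_0\<close> is exactly the indicator of \<open>{0..<x}\<close>.\<close>

definition pospow :: "nat \<Rightarrow> real \<Rightarrow> real" where
  "pospow k u = (if 0 \<le> u then u ^ k else 0)"

text \<open>\<open>exp (- z) * spline k x z\<close> is the density at \<open>z\<close> of the sum of \<open>k + 1\<close> independent unit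
  exponentials on the event that all of them are below \<open>x\<close>.\<close>

definition spline :: "nat \<Rightarrow> real \<Rightarrow> real \<Rightarrow> real" where
  "spline k x z = (\<Sum>j\<le>Suc k. (-1) ^ j * real (Suc k choose j) * pospow k (z - real j * x) / fact k)"

lemma borel_measurable_pospow[measurable]: "pospow k \<in> borel_measurable borel"
  unfolding pospow_def by measurable

lemma borel_measurable_spline[measurable (raw)]:
  assumes [measurable]: "f \<in> borel_measurable K" "g \<in> borel_measurable K"
  shows "(\<lambda>w. spline k (f w) (g w)) \<in> borel_measurable K"
  unfolding spline_def by measurable

text \<open>Pascal's rule for the difference operator: its power \<open>Suc n\<close> at
  \<open>P\<close> is its power \<open>n\<close> at the differences of \<open>P\<close>. Each
  convolution of the spline applies one such difference, whence the binomial coefficients.\<close>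

lemma sum_alternating_choose_Suc:
  fixes P :: "nat \<Rightarrow> real"
  shows "(\<Sum>j\<le>Suc n. (-1) ^ j * real (Suc n choose j) * P j) = (\<Sum>j\<le>n. (-1) ^ j * real (n choose j) * (P j - P (Suc j)))"
proof -
  have "(\<Sum>j\<le>n. (-1) ^ j * real (n choose j) * P j) = (\<Sum>j\<le>Suc n. (-1) ^ j * real (n choose j) * P j)"
    by simp
  also have "\<dots> = P 0 + (\<Sum>j\<le>n. (-1) ^ Suc j * real (n choose Suc j) * P (Suc j))"
    by (subst sum.atMost_Suc_shift) simp
  finally show ?thesis
    by (subst sum.atMost_Suc_shift) (simp add: algebra_simps sum.distrib sum_subtractf sum_negf)
qed

lemma has_integral_pospow:
  assumes "0 \<le> x"
  shows "((\<lambda>y. pospow k (a - y)) has_integral (pospow (Suc k) a - pospow (Suc k) (a - x)) / real (Suc k)) {0..x}"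
proof -
  let ?F = "\<lambda>y. - pospow (Suc k) (a - y) / real (Suc k)"
  have "((\<lambda>y. pospow k (a - y)) has_integral (?F x - ?F 0)) {0..x}"
  \<comment> \<open>For \<open>k = 0\<close> the antiderivative has a kink at \<open>a\<close>; a
    finite exceptional set is allowed because it is continuous there.\<close>
  proof (rule fundamental_theorem_of_calculus_interior_strong[where S="{a}"])
    have "pospow (Suc k) u = (max 0 u) ^ Suc k" for u by (auto simp: pospow_def)
    then show "continuous_on {0..x} ?F" by (auto intro!: continuous_intros)
    fix y assume y: "y \<in> {0<..<x} - {a}"
    show "(?F has_vector_derivative pospow k (a - y)) (at y)"
      unfolding has_real_derivative_iff_has_vector_derivative[symmetric]
    proof (cases "y < a")
      case True
      have "((\<lambda>y. - ((a - y) ^ Suc k) / real (Suc k)) has_real_derivative (a - y) ^ k) (at y)"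
        by (rule derivative_eq_intros refl | simp)+
      then show "(?F has_real_derivative pospow k (a - y)) (at y)"
        using True by (subst (asm) has_field_derivative_cong_ev[where g="?F" and y=y])
          (auto simp: pospow_def intro!: eventually_mono[OF eventually_nhds_in_open[of "{..<a}"]])
    next
      case False
      then have "a < y" using y by auto
      then show "(?F has_real_derivative pospow k (a - y)) (at y)"
        using DERIV_const[of 0 "at y"]
        by (subst (asm) has_field_derivative_cong_ev[where g="?F" and y=y])
          (auto simp: pospow_def intro!: eventually_mono[OF eventually_nhds_in_open[of "{a<..}"]])
    qed
  qed (use assms in auto)
  then show ?thesis by (simp add: diff_divide_distrib)
qed

text \<open>Convolution with the indicator of an interval of length \<open>x\<close> raises the
  degree by one and turns each truncated power into a difference of two shifts by \<open>x\<close>;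
  \<open>sum_alternating_choose_Suc\<close> then merges the shifts.\<close>

lemma has_integral_spline:
  assumes "0 \<le> x"
  shows "((\<lambda>y. spline k x (z - y)) has_integral spline (Suc k) x z) {0..x}"
proof -
  let ?P = "\<lambda>j. pospow (Suc k) (z - real j * x)"
  have "((\<lambda>y. \<Sum>j\<le>Suc k. ((-1) ^ j * real (Suc k choose j) / fact k) * pospow k ((z - real j * x) - y)) has_integral
     (\<Sum>j\<le>Suc k. ((-1) ^ j * real (Suc k choose j) / fact k) * ((?P j - pospow (Suc k) ((z - real j * x) - x)) / real (Suc k)))) {0..x}"
    by (intro has_integral_sum has_integral_mult_right has_integral_pospow assms) simp
  moreover have "(\<lambda>y. \<Sum>j\<le>Suc k. ((-1) ^ j * real (Suc k choose j) / fact k) * pospow k ((z - real j * x) - y)) = (\<lambda>y. spline k x (z - y))"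
    by (intro ext) (simp add: spline_def algebra_simps)
  moreover have "(\<Sum>j\<le>Suc k. ((-1) ^ j * real (Suc k choose j) / fact k) * ((?P j - pospow (Suc k) ((z - real j * x) - x)) / real (Suc k)))
      = (\<Sum>j\<le>Suc k. (-1) ^ j * real (Suc k choose j) * (?P j - ?P (Suc j))) / fact (Suc k)"
  proof -
    have "z - real j * x - x = z - real (Suc j) * x" for j by (simp add: algebra_simps)
    then show ?thesis
      unfolding sum_divide_distrib by (simp only: times_divide_times_eq fact_Suc of_nat_mult of_nat_fact mult.commute[of "fact k"])
  qed
  moreover have "\<dots> = spline (Suc k) x z"
    unfolding spline_def sum_divide_distrib[symmetric] sum_alternating_choose_Suc[of "Suc k" ?P, symmetric] by (rule refl)
  ultimately show ?thesis by simp
qed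

lemma spline_0: "spline 0 x z = pospow 0 z - pospow 0 (z - x)"
  by (simp add: spline_def)

text \<open>The alternating sum hides the sign; the recursion by integration shows it.\<close>

lemma spline_nonneg: "0 \<le> x \<Longrightarrow> 0 \<le> spline k x z"
proof (induction k arbitrary: z)
  case 0
  then show ?case by (auto simp: spline_0 pospow_def)
next
  case (Suc k)
  show ?case
    using has_integral_nonneg[OF has_integral_spline[OF Suc.prems, of k z]] Suc by auto
qed

lemma nn_integral_spline:
  assumes "0 \<le> x"
  shows "(\<integral>\<^sup>+y. ennreal (spline k x (z - y)) * indicator {0..<x} y \<partial>lborel) = ennreal (spline (Suc k) x z)"
proof -
  have "(\<integral>\<^sup>+y. ennreal (spline k x (z - y)) * indicator {0..<x} y \<partial>lborel)
     = (\<integral>\<^sup>+y. ennreal (spline k x (z - y)) * indicator {0..x} y \<partial>lborel)"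
    using AE_lborel_singleton[of x]
    by (intro nn_integral_cong_AE) (auto simp: indicator_def elim!: eventually_mono)
  also have "\<dots> = ennreal (spline (Suc k) x z)"
    by (intro nn_integral_has_integral_lebesgue' has_integral_spline assms spline_nonneg)
  finally show ?thesis .
qed

section \<open>From independent exponentials to the coverage integral\<close>

lemma prob_space_exp1: "prob_space exp1"
  by (rule prob_space_exponential_density) simp

interpretation exp1: product_sigma_finite "\<lambda>_. exp1"
  by (simp add: product_sigma_finite_def prob_space_exp1 prob_space_imp_sigma_finite)

lemma nn_integral_exp1:
  assumes [measurable]: "f \<in> borel_measurable borel"
  shows "(\<integral>\<^sup>+y. f y \<partial>exp1) = (\<integral>\<^sup>+y. ennreal (exp (- y)) * indicator {0..} y * f y \<partial>lborel)"
  by (subst nn_integral_density)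
    (auto simp: exponential_density_def indicator_def intro!: nn_integral_cong)

text \<open>Splitting off one coordinate \<open>t\<close> is a convolution. The weights
  \<open>exp (- t)\<close> and \<open>exp (- (z - t))\<close> multiply to \<open>exp (- z)\<close>,
  which leaves the spline recursion. The function \<open>g\<close> is general because the induction
  hypothesis is needed for its shift by \<open>t\<close>.\<close>

lemma nn_integral_exp1_cube_sum:
  assumes "finite I" "card I = Suc k" "0 \<le> x" and [measurable]: "g \<in> borel_measurable borel"
  shows "(\<integral>\<^sup>+y. (\<Prod>i\<in>I. indicator {0..<x} (y i)) * g (\<Sum>i\<in>I. y i) \<partial>(\<Pi>\<^sub>M i\<in>I. exp1))
    = (\<integral>\<^sup>+z. ennreal (exp (- z) * spline k x z) * g z \<partial>lborel)"
  using assms(1,2,4)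
proof (induction k arbitrary: I g)
  case 0
  note [measurable] = 0(3)
  obtain i where I: "I = {i}" using 0 by (auto simp: card_Suc_eq)
  have "(\<integral>\<^sup>+y. (\<Prod>i\<in>I. indicator {0..<x} (y i)) * g (\<Sum>i\<in>I. y i) \<partial>(\<Pi>\<^sub>M i\<in>I. exp1))
    = (\<integral>\<^sup>+y. (\<lambda>t. indicator {0..<x} t * g t) (y i) \<partial>(\<Pi>\<^sub>M i\<in>{i}. exp1))"
    by (simp add: I)
  also have "\<dots> = (\<integral>\<^sup>+y. indicator {0..<x} y * g y \<partial>exp1)"
    by (rule exp1.product_nn_integral_singleton) measurable
  also have "\<dots> = (\<integral>\<^sup>+z. ennreal (exp (- z) * spline 0 x z) * g z \<partial>lborel)"
    using \<open>0 \<le> x\<close>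
    by (subst nn_integral_exp1) (auto simp: spline_0 pospow_def indicator_def intro!: nn_integral_cong)
  finally show ?case .
next
  case (Suc k)
  note [measurable] = Suc.prems(3)
  obtain i J where I: "I = insert i J" "i \<notin> J" "finite J" "card J = Suc k"
    using Suc.prems by (metis card_Suc_eq finite_insert)
  have "(\<integral>\<^sup>+y. (\<Prod>i\<in>I. indicator {0..<x} (y i)) * g (\<Sum>i\<in>I. y i) \<partial>(\<Pi>\<^sub>M i\<in>I. exp1))
    = (\<integral>\<^sup>+t. (\<integral>\<^sup>+y. (\<Prod>l\<in>I. indicator {0..<x} ((y(i := t)) l)) * g (\<Sum>l\<in>I. (y(i := t)) l) \<partial>(\<Pi>\<^sub>M i\<in>J. exp1)) \<partial>exp1)"
    unfolding I(1) using I by (intro exp1.product_nn_integral_insert_rev) auto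
  also have "\<dots> = (\<integral>\<^sup>+t. indicator {0..<x} t * (\<integral>\<^sup>+z. ennreal (exp (- z) * spline k x z) * g (t + z) \<partial>lborel) \<partial>exp1)"
  proof (rule nn_integral_cong)
    fix t
    have p: "(\<Prod>l\<in>J. indicator {0..<x} ((y(i := t)) l)) = (\<Prod>l\<in>J. indicator {0..<x} (y l) :: ennreal)" for y
      using I by (intro prod.cong) auto
    have s: "(\<Sum>l\<in>J. (y(i := t)) l) = (\<Sum>l\<in>J. y l)" for y
      using I by (intro sum.cong) auto
    have "(\<integral>\<^sup>+y. (\<Prod>l\<in>I. indicator {0..<x} ((y(i := t)) l)) * g (\<Sum>l\<in>I. (y(i := t)) l) \<partial>(\<Pi>\<^sub>M i\<in>J. exp1))
      = (\<integral>\<^sup>+y. indicator {0..<x} t * ((\<Prod>l\<in>J. indicator {0..<x} (y l)) * g (t + (\<Sum>l\<in>J. y l))) \<partial>(\<Pi>\<^sub>M i\<in>J. exp1))"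
      unfolding I(1) using I(2,3) by (intro nn_integral_cong) (simp add: p s mult.assoc del: fun_upd_apply, simp)
    also have "\<dots> = indicator {0..<x} t * (\<integral>\<^sup>+y. (\<Prod>l\<in>J. indicator {0..<x} (y l)) * g (t + (\<Sum>l\<in>J. y l)) \<partial>(\<Pi>\<^sub>M i\<in>J. exp1))"
      by (rule nn_integral_cmult) measurable
    also have "(\<integral>\<^sup>+y. (\<Prod>l\<in>J. indicator {0..<x} (y l)) * g (t + (\<Sum>l\<in>J. y l)) \<partial>(\<Pi>\<^sub>M i\<in>J. exp1))
      = (\<integral>\<^sup>+z. ennreal (exp (- z) * spline k x z) * g (t + z) \<partial>lborel)"
      using I by (intro Suc.IH[where g="\<lambda>z. g (t + z)"]) auto
    finally show "(\<integral>\<^sup>+y. (\<Prod>l\<in>I. indicator {0..<x} ((y(i := t)) l)) * g (\<Sum>l\<in>I. (y(i := t)) l) \<partial>(\<Pi>\<^sub>M i\<in>J. exp1))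
      = indicator {0..<x} t * (\<integral>\<^sup>+z. ennreal (exp (- z) * spline k x z) * g (t + z) \<partial>lborel)" .
  qed
  also have "\<dots> = (\<integral>\<^sup>+t. ennreal (exp (- t)) * indicator {0..<x} t * (\<integral>\<^sup>+z. ennreal (exp (- z) * spline k x z) * g (t + z) \<partial>lborel) \<partial>lborel)"
    by (subst nn_integral_exp1) (auto simp: indicator_def intro!: nn_integral_cong)
  also have "\<dots> = (\<integral>\<^sup>+t. ennreal (exp (- t)) * indicator {0..<x} t * (\<integral>\<^sup>+z. ennreal (exp (- (z - t)) * spline k x (z - t)) * g z \<partial>lborel) \<partial>lborel)"
  proof (rule nn_integral_cong)
    fix t :: real
    have "(\<integral>\<^sup>+z. ennreal (exp (- (z - t)) * spline k x (z - t)) * g z \<partial>lborel)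
      = (\<integral>\<^sup>+z. ennreal (exp (- z) * spline k x z) * g (t + z) \<partial>lborel)"
      by (subst nn_integral_lborel_translation[of _ t, symmetric]) auto
    then show "ennreal (exp (- t)) * indicator {0..<x} t * (\<integral>\<^sup>+z. ennreal (exp (- z) * spline k x z) * g (t + z) \<partial>lborel)
      = ennreal (exp (- t)) * indicator {0..<x} t * (\<integral>\<^sup>+z. ennreal (exp (- (z - t)) * spline k x (z - t)) * g z \<partial>lborel)" by simp
  qed
  also have "\<dots> = (\<integral>\<^sup>+t. \<integral>\<^sup>+z. (ennreal (exp (- z)) * g z) * (ennreal (spline k x (z - t)) * indicator {0..<x} t) \<partial>lborel \<partial>lborel)"
  proof (intro nn_integral_cong)
    fix t
    have "ennreal (exp (- t)) * indicator {0..<x} t * (ennreal (exp (- (z - t)) * spline k x (z - t)) * g z)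
      = (ennreal (exp (- z)) * g z) * (ennreal (spline k x (z - t)) * indicator {0..<x} t)" for z
    proof -
      have "exp (- t) * exp (- (z - t)) = exp (- z)"
        by (simp add: exp_add[symmetric])
      then have "ennreal (exp (- t)) * ennreal (exp (- (z - t))) = ennreal (exp (- z))"
        by (simp add: ennreal_mult[symmetric])
      moreover have "ennreal (exp (- t)) * indicator {0..<x} t * (ennreal (exp (- (z - t)) * spline k x (z - t)) * g z)
        = (ennreal (exp (- t)) * ennreal (exp (- (z - t)))) * g z * (ennreal (spline k x (z - t)) * indicator {0..<x} t)"
        using spline_nonneg[OF \<open>0 \<le> x\<close>, of k "z - t"] by (simp only: ennreal_mult' exp_ge_zero ac_simps)
      ultimately show ?thesis by simp
    qed
    then show "ennreal (exp (- t)) * indicator {0..<x} t * (\<integral>\<^sup>+z. ennreal (exp (- (z - t)) * spline k x (z - t)) * g z \<partial>lborel)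
      = (\<integral>\<^sup>+z. (ennreal (exp (- z)) * g z) * (ennreal (spline k x (z - t)) * indicator {0..<x} t) \<partial>lborel)"
      by (subst nn_integral_cmult[symmetric]) auto
  qed
  also have "\<dots> = (\<integral>\<^sup>+z. \<integral>\<^sup>+t. (ennreal (exp (- z)) * g z) * (ennreal (spline k x (z - t)) * indicator {0..<x} t) \<partial>lborel \<partial>lborel)"
    by (rule lborel_pair.Fubini') measurable
  also have "\<dots> = (\<integral>\<^sup>+z. (ennreal (exp (- z)) * g z) * ennreal (spline (Suc k) x z) \<partial>lborel)"
    using \<open>0 \<le> x\<close> by (subst nn_integral_cmult) (auto simp: nn_integral_spline)
  also have "\<dots> = (\<integral>\<^sup>+z. ennreal (exp (- z) * spline (Suc k) x z) * g z \<partial>lborel)"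
    using \<open>0 \<le> x\<close> by (intro nn_integral_cong) (simp add: ennreal_mult spline_nonneg ac_simps)
  finally show ?case .
qed

lemma AE_PiM_exp1_nonneg:
  assumes "finite I"
  shows "AE x in \<Pi>\<^sub>M i\<in>I. exp1. \<forall>i\<in>I. 0 \<le> x i"
proof (rule AE_finite_allI[OF assms])
  fix i assume "i \<in> I"
  show "AE x in \<Pi>\<^sub>M i\<in>I. exp1. 0 \<le> x i"
    by (rule AE_PiM_component[OF prob_space_exp1 \<open>i \<in> I\<close>])
      (auto simp: AE_density exponential_density_def)
qed

text \<open>Once all coordinates except \<open>i\<close> are fixed, a tie happens at a single value
  of \<open>x i\<close>.\<close>

lemma AE_PiM_exp1_neq:
  assumes "finite I" "i \<in> I" "j \<in> I" "i \<noteq> j"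
  shows "AE x in \<Pi>\<^sub>M i\<in>I. exp1. x i \<noteq> x j"
proof -
  define J where "J = I - {i}"
  have I: "I = insert i J" "finite J" "i \<notin> J" and [measurable]: "j \<in> J"
    using assms by (auto simp: J_def)
  have [measurable]: "i \<in> insert i J" "j \<in> insert i J" using assms(3) I by auto
  let ?S = "{x \<in> space (\<Pi>\<^sub>M i\<in>insert i J. exp1). x i = x j}"
  have [measurable]: "?S \<in> sets (\<Pi>\<^sub>M i\<in>insert i J. exp1)" by measurable
  have "emeasure (\<Pi>\<^sub>M i\<in>insert i J. exp1) ?S = (\<integral>\<^sup>+x. indicator ?S x \<partial>(\<Pi>\<^sub>M i\<in>insert i J. exp1))"
    by simp
  also have "\<dots> = (\<integral>\<^sup>+y. (\<integral>\<^sup>+t. indicator ?S (y(i := t)) \<partial>exp1) \<partial>(\<Pi>\<^sub>M i\<in>J. exp1))"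
    using I by (intro exp1.product_nn_integral_insert) auto
  also have "\<dots> = (\<integral>\<^sup>+y. 0 \<partial>(\<Pi>\<^sub>M i\<in>J. exp1))"
  proof (rule nn_integral_cong)
    fix y assume "y \<in> space (\<Pi>\<^sub>M i\<in>J. exp1)"
    then have "(\<integral>\<^sup>+t. indicator ?S (y(i := t)) \<partial>exp1) = (\<integral>\<^sup>+t. indicator {y j} t \<partial>exp1)"
      using assms(4) by (intro nn_integral_cong) (auto simp: indicator_def space_PiM PiE_def extensional_def)
    also have "\<dots> = (\<integral>\<^sup>+t. ennreal (exp (- t)) * indicator {0..} t * indicator {y j} t \<partial>lborel)"
      by (rule nn_integral_exp1) measurable
    also have "\<dots> = (\<integral>\<^sup>+(t::real). 0 \<partial>lborel)"
      using AE_lborel_singleton[of "y j"]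
      by (intro nn_integral_cong_AE) (auto elim!: eventually_mono)
    finally show "(\<integral>\<^sup>+t. indicator ?S (y(i := t)) \<partial>exp1) = 0" by simp
  qed
  finally have "emeasure (\<Pi>\<^sub>M i\<in>insert i J. exp1) ?S = 0" by simp
  then show ?thesis
    unfolding I(1) by (subst AE_iff_measurable[where N="?S"]) auto
qed

text \<open>The total of all gains is fixed, so passing from a covered beam to a strongest one
  cannot lower the gain or raise the interference.\<close>

lemma covered_at_maximum:
  assumes pos: "\<forall>i\<in>{1..N}. 0 \<le> x i" and T: "0 < T" and cov: "covered N c T x"
  obtains m where "m \<in> {1..N}" "\<forall>i\<in>{1..N}. x i \<le> x m" "T * (c + (\<Sum>i\<in>{1..N} - {m}. x i)) < x m"
proof -
  obtain n where n: "n \<in> {1..N}" "T * (c + (\<Sum>i\<in>{1..N} - {n}. x i)) < x n"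
    using cov by (auto simp: covered_def)
  have ne: "x ` {1..N} \<noteq> {}" using n by auto
  obtain m where m: "m \<in> {1..N}" "x m = Max (x ` {1..N})"
    using Max_in[OF _ ne] by auto
  have max: "x i \<le> x m" if "i \<in> {1..N}" for i
    unfolding m(2) using that by (intro Max_ge) auto
  have "(\<Sum>i\<in>{1..N} - {m}. x i) \<le> (\<Sum>i\<in>{1..N} - {n}. x i)"
    using max[OF n(1)] sum.remove[OF finite_atLeastAtMost m(1), of x] sum.remove[OF finite_atLeastAtMost n(1), of x]
    by linarith
  then have "T * (c + (\<Sum>i\<in>{1..N} - {m}. x i)) \<le> T * (c + (\<Sum>i\<in>{1..N} - {n}. x i))"
    using T by simp
  then have "T * (c + (\<Sum>i\<in>{1..N} - {m}. x i)) < x m"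
    using n(2) max[OF n(1)] by linarith
  then show thesis
    using m(1) max by (intro that[of m]) blast+
qed

text \<open>Almost surely the strongest beam is unique. So the events \<open>A n\<close>, with
  \<open>n\<close> strictly strongest and above the threshold, are disjoint and exhaust coverage up
  to a null set. They all have the same measure, which gives the factor \<open>N\<close>; inside
  \<open>A n\<close> the other gains are capped by the value of the \<open>n\<close>th.\<close>

lemma emeasure_covered:
  assumes N: "N = Suc (Suc k)" and "0 < T"
  shows "emeasure (\<Pi>\<^sub>M n\<in>{1..N}. exp1) {x \<in> space (\<Pi>\<^sub>M n\<in>{1..N}. exp1). covered N c T x} =
    of_nat N * (\<integral>\<^sup>+x. ennreal (exp (- x)) * indicator {0..} x *
       (\<integral>\<^sup>+z. ennreal (exp (- z) * spline k x z) * indicator {z. T * (c + z) < x} z \<partial>lborel) \<partial>lborel)"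
proof -
  note One_nat_def[simp del]
  let ?P = "\<Pi>\<^sub>M n\<in>{1..N}. exp1"
  define A where "A n = {x \<in> space ?P. (\<forall>i\<in>{1..N}. 0 \<le> x i) \<and> (\<forall>i\<in>{1..N} - {n}. x i < x n) \<and>
    T * (c + (\<Sum>i\<in>{1..N} - {n}. x i)) < x n}" for n
  have A[measurable]: "A n \<in> sets ?P" if [measurable]: "n \<in> {1..N}" for n
    unfolding A_def by measurable
  have "emeasure ?P {x \<in> space ?P. covered N c T x} = emeasure ?P (\<Union>n\<in>{1..N}. A n)"
  proof (rule emeasure_eq_AE)
    have "AE x in ?P. \<forall>i\<in>{1..N}. \<forall>j\<in>{1..N} - {i}. x i \<noteq> x j"
      by (intro AE_finite_allI) (auto intro!: AE_PiM_exp1_neq)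
    with AE_PiM_exp1_nonneg[of "{1..N}", simplified]
    show "AE x in ?P. x \<in> {x \<in> space ?P. covered N c T x} \<longleftrightarrow> x \<in> (\<Union>n\<in>{1..N}. A n)"
    proof eventually_elim
      case (elim x)
      show ?case
      proof
        assume "x \<in> {x \<in> space ?P. covered N c T x}"
        then have x: "x \<in> space ?P" "covered N c T x" by auto
        obtain m where m: "m \<in> {1..N}" "\<forall>i\<in>{1..N}. x i \<le> x m" "T * (c + (\<Sum>i\<in>{1..N} - {m}. x i)) < x m"
          using covered_at_maximum[OF elim(1) \<open>0 < T\<close> x(2)] .
        have "x i < x m" if "i \<in> {1..N} - {m}" for i
        proof -
          have "x i \<le> x m" using m(2) that by blast
          moreover have "x m \<noteq> x i" using elim(2) m(1) that by blast
          ultimately show ?thesis by simp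
        qed
        then have "x \<in> A m"
          using m x elim(1) by (simp add: A_def)
        then show "x \<in> (\<Union>n\<in>{1..N}. A n)" using m(1) by blast
      next
        assume "x \<in> (\<Union>n\<in>{1..N}. A n)"
        then show "x \<in> {x \<in> space ?P. covered N c T x}"
          unfolding A_def covered_def by blast
      qed
    qed
    show "{x \<in> space ?P. covered N c T x} \<in> sets ?P" by measurable
    show "(\<Union>n\<in>{1..N}. A n) \<in> sets ?P" using A by blast
  qed
  also have "\<dots> = (\<Sum>n\<in>{1..N}. emeasure ?P (A n))"
  proof (rule sum_emeasure[symmetric])
    show "A ` {1..N} \<subseteq> sets ?P" using A by blast
    show "disjoint_family_on A {1..N}"
      unfolding disjoint_family_on_def
    proof (intro ballI impI)
      fix n m assume nm: "n \<in> {1..N}" "m \<in> {1..N}" "n \<noteq> m"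
      have "x m < x n \<and> x n < x m" if "x \<in> A n \<inter> A m" for x
        using that nm unfolding A_def by blast
      then show "A n \<inter> A m = {}" by (meson equals0I less_asym)
    qed
  qed simp
  also have "\<dots> = (\<Sum>n\<in>{1..N}. (\<integral>\<^sup>+x. ennreal (exp (- x)) * indicator {0..} x *
       (\<integral>\<^sup>+z. ennreal (exp (- z) * spline k x z) * indicator {z. T * (c + z) < x} z \<partial>lborel) \<partial>lborel))"
  proof (rule sum.cong[OF refl])
    fix n assume n: "n \<in> {1..N}"
    define I where "I = {1..N} - {n}"
    have I: "{1..N} = insert n I" "n \<notin> I" "finite I" "card I = Suc k"
      using n N by (auto simp: I_def)
    note A' = A[OF n, unfolded I(1)]
    have "emeasure ?P (A n) = (\<integral>\<^sup>+x. indicator (A n) x \<partial>?P)"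
      using A[OF n] by simp
    also have "\<dots> = (\<integral>\<^sup>+t. (\<integral>\<^sup>+y. indicator (A n) (y(n := t)) \<partial>(\<Pi>\<^sub>M i\<in>I. exp1)) \<partial>exp1)"
      unfolding I(1) using I(2,3) A' by (intro exp1.product_nn_integral_insert_rev) auto
    also have "\<dots> = (\<integral>\<^sup>+t. indicator {0..} t * (\<integral>\<^sup>+z. ennreal (exp (- z) * spline k t z) * indicator {z. T * (c + z) < t} z \<partial>lborel) \<partial>exp1)"
    proof (rule nn_integral_cong)
      fix t
      have "(\<integral>\<^sup>+y. indicator (A n) (y(n := t)) \<partial>(\<Pi>\<^sub>M i\<in>I. exp1))
        = (\<integral>\<^sup>+y. indicator {0..} t * ((\<Prod>i\<in>I. indicator {0..<t} (y i)) * indicator {z. T * (c + z) < t} (\<Sum>i\<in>I. y i)) \<partial>(\<Pi>\<^sub>M i\<in>I. exp1))"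
      proof (rule nn_integral_cong)
        fix y assume y: "y \<in> space (\<Pi>\<^sub>M i\<in>I. exp1)"
        have s: "(\<Sum>i\<in>I. (y(n := t)) i) = (\<Sum>i\<in>I. y i)"
          using I(2) by (intro sum.cong) auto
        have sp: "y(n := t) \<in> space ?P"
          using y unfolding I(1) space_PiM by (auto simp: PiE_def extensional_def)
        have neq: "i \<noteq> n" if "i \<in> I" for i using that I(2) by auto
        have mem: "y(n := t) \<in> A n \<longleftrightarrow> 0 \<le> t \<and> (\<forall>i\<in>I. y i \<in> {0..<t}) \<and> T * (c + (\<Sum>i\<in>I. y i)) < t"
          unfolding A_def I_def[symmetric] s using sp neq by (auto simp: I(1) simp del: fun_upd_apply) (auto simp: neq)
        have pr: "(\<Prod>i\<in>I. indicator {0..<t} (y i)) = (of_bool (\<forall>i\<in>I. y i \<in> {0..<t}) :: ennreal)"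
        proof (cases "\<forall>i\<in>I. y i \<in> {0..<t}")
          case False
          then obtain i where "i \<in> I" "y i \<notin> {0..<t}" by blast
          then have "(\<Prod>i\<in>I. indicator {0..<t} (y i)) = (0 :: ennreal)"
            using I(3) by (intro prod_zero bexI[of _ i]) auto
          then show ?thesis using False by simp
        qed simp
        show "indicator (A n) (y(n := t)) = indicator {0..} t * ((\<Prod>i\<in>I. indicator {0..<t} (y i)) * indicator {z. T * (c + z) < t} (\<Sum>i\<in>I. y i) :: ennreal)"
          unfolding pr indicator_def mem using I(3) by auto
      qed
      also have "\<dots> = indicator {0..} t * (\<integral>\<^sup>+y. (\<Prod>i\<in>I. indicator {0..<t} (y i)) * indicator {z. T * (c + z) < t} (\<Sum>i\<in>I. y i) \<partial>(\<Pi>\<^sub>M i\<in>I. exp1))"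
        by (rule nn_integral_cmult) measurable
      also have "\<dots> = indicator {0..} t * (\<integral>\<^sup>+z. ennreal (exp (- z) * spline k t z) * indicator {z. T * (c + z) < t} z \<partial>lborel)"
      proof (cases "0 \<le> t")
        case True
        then show ?thesis using I by (subst nn_integral_exp1_cube_sum[OF I(3,4)]) auto
      qed simp
      finally show "(\<integral>\<^sup>+y. indicator (A n) (y(n := t)) \<partial>(\<Pi>\<^sub>M i\<in>I. exp1))
        = indicator {0..} t * (\<integral>\<^sup>+z. ennreal (exp (- z) * spline k t z) * indicator {z. T * (c + z) < t} z \<partial>lborel)" .
    qed
    also have "\<dots> = (\<integral>\<^sup>+x. ennreal (exp (- x)) * indicator {0..} x *
       (\<integral>\<^sup>+z. ennreal (exp (- z) * spline k x z) * indicator {z. T * (c + z) < x} z \<partial>lborel) \<partial>lborel)"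
      by (subst nn_integral_exp1) (auto intro!: nn_integral_cong simp: indicator_def)
    finally show "emeasure ?P (A n) = \<dots>" .
  qed
  finally show ?thesis by simp
qed

text \<open>A single beam has no interferers, and the spline needs at least one; this case is a
  plain exponential tail.\<close>

lemma measure_covered_1:
  assumes "0 \<le> T * c"
  shows "measure (\<Pi>\<^sub>M n\<in>{1..1}. exp1) {x \<in> space (\<Pi>\<^sub>M n\<in>{1..1}. exp1). covered 1 c T x} = exp (- (T * c))"
proof -
  let ?P = "\<Pi>\<^sub>M n\<in>{1::nat}. exp1"
  have "emeasure ?P {x \<in> space ?P. T * c < x 1} = (\<integral>\<^sup>+x. indicator {x \<in> space ?P. T * c < x 1} x \<partial>?P)"
    by (simp del: One_nat_def)
  also have "\<dots> = (\<integral>\<^sup>+x. indicator {T * c<..} (x 1) \<partial>?P)"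
    by (intro nn_integral_cong) (auto simp: indicator_def)
  also have "\<dots> = (\<integral>\<^sup>+t. indicator {T * c<..} t \<partial>exp1)"
    by (rule exp1.product_nn_integral_singleton) measurable
  also have "\<dots> = (\<integral>\<^sup>+t. ennreal (exp (- t)) * indicator {0..} t * indicator {T * c<..} t \<partial>lborel)"
    by (rule nn_integral_exp1) measurable
  also have "\<dots> = (\<integral>\<^sup>+t. ennreal (exp (- t)) * indicator {T * c..} t \<partial>lborel)"
    using AE_lborel_singleton[of "T * c"] assms
    by (intro nn_integral_cong_AE) (auto simp: indicator_def elim!: eventually_mono)
  also have "\<dots> = ennreal (exp (- (T * c)))"
    by (rule nn_integral_exp_tail)
  finally have "measure ?P {x \<in> space ?P. T * c < x 1} = exp (- (T * c))"
    by (simp add: measure_def)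
  then show ?thesis by (simp add: covered_def)
qed

section \<open>Incomplete gamma integrals\<close>

text \<open>For \<open>a > 0\<close> and \<open>b \<ge> 0\<close> this is the integral of
  \<open>z ^ p * exp (- a * z)\<close> over \<open>z \<ge> b\<close>, a scaled upper incomplete
  gamma function. All the \<open>C\<close>, \<open>D\<close>, \<open>E\<close> and \<open>F\<close>
  terms are built from it.\<close>

definition gamma_tail :: "nat \<Rightarrow> real \<Rightarrow> real \<Rightarrow> real" where
  "gamma_tail p a b = fact p / a ^ (p + 1) * exp (- a * b) * (\<Sum>u=0..p. a ^ u * b ^ u / fact u)"

text \<open>What integration by parts gives for that integral; it carries the induction for the
  derivative.\<close>

lemma gamma_tail_Suc:
  assumes "a \<noteq> 0"
  shows "gamma_tail (Suc p) a b = real (Suc p) / a * gamma_tail p a b + b ^ Suc p * exp (- a * b) / a"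
proof -
  have "gamma_tail (Suc p) a b = fact (Suc p) / a ^ (Suc p + 1) * exp (- a * b) * (\<Sum>u=0..p. a ^ u * b ^ u / fact u)
     + fact (Suc p) / a ^ (Suc p + 1) * exp (- a * b) * (a ^ Suc p * b ^ Suc p / fact (Suc p))"
    by (simp add: gamma_tail_def distrib_left del: fact_Suc)
  also have "fact (Suc p) / a ^ (Suc p + 1) * exp (- a * b) * (\<Sum>u=0..p. a ^ u * b ^ u / fact u) = real (Suc p) / a * gamma_tail p a b"
    using assms by (simp add: gamma_tail_def)
  also have "fact (Suc p) / a ^ (Suc p + 1) * exp (- a * b) * (a ^ Suc p * b ^ Suc p / fact (Suc p)) = b ^ Suc p * exp (- a * b) / a"
    using assms by (simp add: field_simps del: fact_Suc)
  finally show ?thesis .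
qed

lemma gamma_tail_has_derivative:
  assumes "0 < a"
  shows "((\<lambda>b. gamma_tail p a b) has_real_derivative - (b ^ p * exp (- a * b))) (at b)"
proof (induction p)
  case 0
  show ?case using assms
    unfolding gamma_tail_def by (auto intro!: derivative_eq_intros)
next
  case (Suc p)
  have "((\<lambda>b. real (Suc p) / a * gamma_tail p a b + b ^ Suc p * exp (- a * b) / a) has_real_derivative
     real (Suc p) / a * - (b ^ p * exp (- a * b)) + (real (Suc p) * b ^ p * exp (- a * b) + b ^ Suc p * (exp (- a * b) * - a)) / a) (at b)"
  proof (intro DERIV_add DERIV_cmult Suc DERIV_cdivide)
    show "((\<lambda>b. b ^ Suc p * exp (- a * b)) has_real_derivative real (Suc p) * b ^ p * exp (- a * b) + b ^ Suc p * (exp (- a * b) * - a)) (at b)"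
    proof (rule DERIV_cong[OF DERIV_mult])
      show "((\<lambda>b. b ^ Suc p) has_real_derivative real (Suc p) * b ^ p) (at b)"
        using DERIV_pow[of "Suc p" b] by simp
      show "((\<lambda>b. exp (- a * b)) has_real_derivative exp (- a * b) * - a) (at b)"
        by (auto intro!: derivative_eq_intros)
    qed (simp add: mult_ac)
  qed
  also have "real (Suc p) / a * - (b ^ p * exp (- a * b)) + (real (Suc p) * b ^ p * exp (- a * b) + b ^ Suc p * (exp (- a * b) * - a)) / a
      = - (b ^ Suc p * exp (- a * b))"
    using assms by (simp add: field_simps)
  also have "(\<lambda>b. real (Suc p) / a * gamma_tail p a b + b ^ Suc p * exp (- a * b) / a) = gamma_tail (Suc p) a"
    using assms by (intro ext gamma_tail_Suc[symmetric]) simp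
  finally show ?case .
qed

lemma gamma_tail_tendsto_0:
  assumes "0 < a"
  shows "((\<lambda>b. gamma_tail p a b) \<longlongrightarrow> 0) at_top"
proof -
  have "((\<lambda>b. (a * b) ^ u / exp (a * b)) \<longlongrightarrow> 0) at_top" for u
    by (rule filterlim_compose[OF tendsto_power_div_exp_0])
      (rule filterlim_tendsto_pos_mult_at_top[OF tendsto_const assms filterlim_ident])
  then have "((\<lambda>b. fact p / a ^ (p + 1) * (\<Sum>u=0..p. ((a * b) ^ u / exp (a * b)) / fact u)) \<longlongrightarrow>
      fact p / a ^ (p + 1) * (\<Sum>u=0..p. 0 / fact u)) at_top"
    by (intro tendsto_intros) auto
  then show ?thesis
    by (simp add: gamma_tail_def exp_minus field_simps sum_distrib_left)
qed

lemma has_bochner_integral_gamma_tail: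
  assumes "0 < a" "0 \<le> b"
  shows "has_bochner_integral lborel (\<lambda>z. indicator {b..} z * (z ^ p * exp (- a * z))) (gamma_tail p a b)"
proof (rule has_bochner_integral_nn_integral)
  have "(\<integral>\<^sup>+z. ennreal (indicator {b..} z * (z ^ p * exp (- a * z))) \<partial>lborel)
      = (\<integral>\<^sup>+z. ennreal (z ^ p * exp (- a * z)) * indicator {b..} z \<partial>lborel)"
    by (intro nn_integral_cong) (auto simp: indicator_def)
  also have "\<dots> = ennreal (- 0 - - gamma_tail p a b)"
  proof (rule nn_integral_FTC_atLeast)
    show "DERIV (\<lambda>b. - gamma_tail p a b) x :> x ^ p * exp (- a * x)" for x
      using DERIV_minus[OF gamma_tail_has_derivative[OF assms(1), of p x]] by simp
    show "((\<lambda>b. - gamma_tail p a b) \<longlongrightarrow> - 0) at_top"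
      by (intro tendsto_minus gamma_tail_tendsto_0 assms)
  qed (use assms in auto)
  finally show "(\<integral>\<^sup>+z. ennreal (indicator {b..} z * (z ^ p * exp (- a * z))) \<partial>lborel) = ennreal (gamma_tail p a b)" by simp
  show "0 \<le> gamma_tail p a b"
    using assms unfolding gamma_tail_def by (intro mult_nonneg_nonneg sum_nonneg) auto
  show "AE z in lborel. 0 \<le> indicator {b..} z * (z ^ p * exp (- a * z))"
    using assms by (auto simp: indicator_def)
qed measurable

text \<open>The tail integral of \<open>(z - real j * x) ^ k * exp (- x)\<close> over
  \<open>x \<ge> a\<close>, with the power expanded binomially.\<close>

definition inner_part :: "nat \<Rightarrow> nat \<Rightarrow> real \<Rightarrow> real \<Rightarrow> real" where
  "inner_part k j z a = (\<Sum>i\<le>k. real (k choose i) * (- real j) ^ i * z ^ (k - i) * gamma_tail i 1 a)"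

lemma has_integral_inner_part:
  assumes "A \<le> B"
  shows "((\<lambda>x. (z - real j * x) ^ k * exp (- x)) has_integral inner_part k j z A - inner_part k j z B) {A..B}"
proof -
  have "((\<lambda>x. - inner_part k j z x) has_real_derivative (z - real j * x) ^ k * exp (- x)) (at x)" for x
  proof -
    have "((\<lambda>x. - inner_part k j z x) has_real_derivative
        - (\<Sum>i\<le>k. real (k choose i) * (- real j) ^ i * z ^ (k - i) * - (x ^ i * exp (- 1 * x)))) (at x)"
      unfolding inner_part_def
      by (intro DERIV_minus DERIV_sum DERIV_cmult gamma_tail_has_derivative) simp
    also have "- (\<Sum>i\<le>k. real (k choose i) * (- real j) ^ i * z ^ (k - i) * - (x ^ i * exp (- 1 * x)))
        = (\<Sum>i\<le>k. real (k choose i) * (- real j * x) ^ i * z ^ (k - i)) * exp (- x)"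
      unfolding sum_negf[symmetric] sum_distrib_right power_mult_distrib
      by (intro sum.cong refl) (simp add: mult_ac)
    also have "(\<Sum>i\<le>k. real (k choose i) * (- real j * x) ^ i * z ^ (k - i)) = (z - real j * x) ^ k"
      using binomial_ring[of "- real j * x" z k] by (simp add: add.commute)
    finally show ?thesis .
  qed
  then have "((\<lambda>x. (z - real j * x) ^ k * exp (- x)) has_integral - inner_part k j z B - - inner_part k j z A) {A..B}"
    using assms
    by (intro fundamental_theorem_of_calculus) (auto simp: has_real_derivative_iff_has_vector_derivative[symmetric] intro: has_field_derivative_at_within)
  then show ?thesis by simp
qed

text \<open>The integral over \<open>z \<ge> b\<close> of \<open>exp (- z)\<close> times the inner
  integral from \<open>T * (c + z)\<close> to \<open>z / j\<close>. The rates \<open>T + 1\<close>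
  and \<open>(j + 1) / j\<close> come from multiplying \<open>exp (- z)\<close> by the exponentials
  at these two ends. The sum over \<open>l\<close> is the finite series of the incomplete gamma
  function, and the sum over \<open>v\<close> expands \<open>(c + z) ^ l\<close>.\<close>

definition outer_part :: "nat \<Rightarrow> real \<Rightarrow> real \<Rightarrow> real \<Rightarrow> nat \<Rightarrow> real" where
  "outer_part k c T b j = (\<Sum>i\<le>k. real (k choose i) * (- real j) ^ i * fact i *
     (\<Sum>l=0..i. exp (- (T * c)) * (T ^ l / fact l) * (\<Sum>v=0..l. real (l choose v) * c ^ (l - v) * gamma_tail (k - i + v) (T + 1) b)
        - 1 / (real j ^ l * fact l) * gamma_tail (k - i + l) ((real j + 1) / real j) b))"

lemma has_bochner_integral_outer_part:
  assumes "0 \<le> b" "0 < j" "0 < T"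
  shows "has_bochner_integral lborel (\<lambda>z. indicator {b..} z * (exp (- z) * (inner_part k j z (T * (c + z)) - inner_part k j z (z / real j))))
    (outer_part k c T b j)"
proof -
  let ?s = "\<lambda>z. \<Sum>i\<le>k. real (k choose i) * (- real j) ^ i * fact i *
     (\<Sum>l=0..i. exp (- (T * c)) * (T ^ l / fact l) * (\<Sum>v=0..l. real (l choose v) * c ^ (l - v) * (indicator {b..} z * (z ^ (k - i + v) * exp (- (T + 1) * z))))
        - 1 / (real j ^ l * fact l) * (indicator {b..} z * (z ^ (k - i + l) * exp (- ((real j + 1) / real j) * z))))"
  have "has_bochner_integral lborel ?s (outer_part k c T b j)"
    unfolding outer_part_def using assms
    by (intro has_bochner_integral_sum has_bochner_integral_mult_right has_bochner_integral_diff has_bochner_integral_gamma_tail) auto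
  moreover have "?s z = indicator {b..} z * (exp (- z) * (inner_part k j z (T * (c + z)) - inner_part k j z (z / real j)))" for z
  proof -
    have 1: "exp (- (T * c)) * (T ^ l / fact l) * (\<Sum>v=0..l. real (l choose v) * c ^ (l - v) * (indicator {b..} z * (z ^ (p + v) * exp (- (T + 1) * z))))
      = indicator {b..} z * exp (- z) * z ^ p * (exp (- (T * (c + z))) * ((T * (c + z)) ^ l / fact l))" for l p
    proof -
      have "(\<Sum>v=0..l. real (l choose v) * c ^ (l - v) * (indicator {b..} z * (z ^ (p + v) * exp (- (T + 1) * z))))
        = indicator {b..} z * exp (- (T + 1) * z) * z ^ p * (\<Sum>v=0..l. real (l choose v) * z ^ v * c ^ (l - v))"
        by (simp add: sum_distrib_left power_add mult_ac)
      also have "(\<Sum>v=0..l. real (l choose v) * z ^ v * c ^ (l - v)) = (c + z) ^ l"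
        using binomial_ring[of z c l] by (simp add: atLeast0AtMost add.commute)
      finally have e: "(\<Sum>v=0..l. real (l choose v) * c ^ (l - v) * (indicator {b..} z * (z ^ (p + v) * exp (- (T + 1) * z))))
        = indicator {b..} z * exp (- (T + 1) * z) * z ^ p * (c + z) ^ l" .
      have "exp (- (T * c)) * exp (- (T + 1) * z) = exp (- z) * exp (- (T * (c + z)))"
        by (simp add: exp_add[symmetric] algebra_simps)
      moreover have "exp (- (T * c)) * (T ^ l / fact l) * (indicator {b..} z * exp (- (T + 1) * z) * z ^ p * (c + z) ^ l)
        = (exp (- (T * c)) * exp (- (T + 1) * z)) * (T ^ l / fact l) * (indicator {b..} z * z ^ p * (c + z) ^ l)"
        by (simp only: mult_ac)
      ultimately have "exp (- (T * c)) * (T ^ l / fact l) * (indicator {b..} z * exp (- (T + 1) * z) * z ^ p * (c + z) ^ l)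
        = (exp (- z) * exp (- (T * (c + z)))) * (T ^ l / fact l) * (indicator {b..} z * z ^ p * (c + z) ^ l)"
        by simp
      then show ?thesis unfolding e by (simp add: power_mult_distrib mult_ac)
    qed
    have 2: "1 / (real j ^ l * fact l) * (indicator {b..} z * (z ^ (p + l) * exp (- ((real j + 1) / real j) * z)))
      = indicator {b..} z * exp (- z) * z ^ p * (exp (- (z / real j)) * ((z / real j) ^ l / fact l))" for l p
    proof -
      have "- ((real j + 1) / real j) * z = - z + - (z / real j)"
        using assms by (simp add: field_simps)
      then have "exp (- ((real j + 1) / real j) * z) = exp (- z) * exp (- (z / real j))"
        by (simp only: exp_add)
      then show ?thesis by (simp add: power_add power_divide mult_ac)
    qed
    define S where "S i a = (\<Sum>l=0..i. exp (- a) * (a ^ l / fact l))" for i :: nat and a :: real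
    have g: "gamma_tail i 1 a = fact i * S i a" for i a
      by (simp add: gamma_tail_def S_def sum_distrib_left mult.assoc)
    have "?s z = (\<Sum>i\<le>k. real (k choose i) * (- real j) ^ i * fact i *
        (indicator {b..} z * exp (- z) * z ^ (k - i) * (S i (T * (c + z)) - S i (z / real j))))"
      unfolding 1 2 sum_subtractf S_def sum_distrib_left[symmetric] right_diff_distrib ..
    also have "\<dots> = indicator {b..} z * (exp (- z) * (inner_part k j z (T * (c + z)) - inner_part k j z (z / real j)))"
      unfolding inner_part_def g sum_subtractf[symmetric] sum_distrib_left
      by (intro sum.cong refl) (simp add: algebra_simps)
    finally show ?thesis .
  qed
  ultimately show ?thesis by simp
qed

section \<open>Double integrals of the single truncated powers\<close>

definition kern :: "nat \<Rightarrow> real \<Rightarrow> real \<Rightarrow> nat \<Rightarrow> real \<Rightarrow> real \<Rightarrow> real" where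
  "kern k c T j x z = indicator {0..} x * indicator {z. T * (c + z) < x} z * exp (- x) * exp (- z) * pospow k (z - real j * x)"

text \<open>For \<open>j > 0\<close> the integrand lives on
  \<open>T * (c + z) < x \<le> z / j\<close>. If \<open>j * T < 1\<close> this interval is nonempty
  exactly for \<open>z\<close> above \<open>T * c / (1 / j - T)\<close>; otherwise it is empty for
  all \<open>z \<ge> 0\<close>. For \<open>j = 0\<close> there is no upper end, hence the plain tail
  from \<open>0\<close>.\<close>

definition kern_integral :: "nat \<Rightarrow> real \<Rightarrow> real \<Rightarrow> nat \<Rightarrow> real" where
  "kern_integral k c T j =
    (if j = 0 then exp (- (T * c)) * gamma_tail k (T + 1) 0
     else if real j * T < 1 then outer_part k c T (T * c / (1 / real j - T)) j else 0)"

lemma borel_measurable_kern[measurable (raw)]: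
  assumes [measurable]: "f \<in> borel_measurable K" "g \<in> borel_measurable K"
  shows "(\<lambda>w. kern k c T j (f w) (g w)) \<in> borel_measurable K"
  unfolding kern_def by measurable

lemma kern_nonneg: "0 \<le> kern k c T j x z"
  by (auto simp: kern_def pospow_def indicator_def)

lemma nn_integral_has_bochner_integral:
  assumes "has_bochner_integral K f I" "\<And>x. 0 \<le> f x"
  shows "(\<integral>\<^sup>+x. ennreal (f x) \<partial>K) = ennreal I"
  using assms nn_integral_eq_integral[of K f] by (auto simp: has_bochner_integral_iff)

lemma has_bochner_integral_ge_0:
  fixes f :: "'b \<Rightarrow> real"
  assumes "has_bochner_integral K f I" "\<And>x. 0 \<le> f x"
  shows "0 \<le> I"
  using assms integral_nonneg_AE[of f K] by (auto simp: has_bochner_integral_iff)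

lemma kern_inner_0:
  assumes "0 < c" "0 < T"
  shows "(\<integral>\<^sup>+x. ennreal (kern k c T 0 x z) \<partial>lborel) = ennreal (exp (- (T * c)) * (indicator {0..} z * (z ^ k * exp (- (T + 1) * z))))"
proof (cases "0 \<le> z")
  case True
  have "(\<integral>\<^sup>+x. ennreal (kern k c T 0 x z) \<partial>lborel)
      = (\<integral>\<^sup>+x. ennreal (exp (- z) * z ^ k) * (ennreal (exp (- x)) * indicator {T * (c + z)..} x) \<partial>lborel)"
  proof (rule nn_integral_cong_AE, use AE_lborel_singleton[of "T * (c + z)"] in eventually_elim)
    case (elim x)
    have "0 < T * (c + z)" using assms True by simp
    then show ?case
      using elim True by (auto simp: kern_def pospow_def indicator_def ennreal_mult[symmetric] mult_ac)
  qed
  also have "\<dots> = ennreal (exp (- z) * z ^ k) * ennreal (exp (- (T * (c + z))))"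
    by (subst nn_integral_cmult) (auto simp: nn_integral_exp_tail)
  also have "\<dots> = ennreal (exp (- (T * c)) * (indicator {0..} z * (z ^ k * exp (- (T + 1) * z))))"
  proof -
    have "exp (- z) * exp (- (T * (c + z))) = exp (- (T * c)) * exp (- (T + 1) * z)"
      by (simp add: exp_add[symmetric] algebra_simps)
    then have "exp (- z) * z ^ k * exp (- (T * (c + z))) = exp (- (T * c)) * (z ^ k * exp (- (T + 1) * z))"
      by (simp only: mult_ac)
    then show ?thesis using True by (simp add: ennreal_mult[symmetric])
  qed
  finally show ?thesis .
next
  case False
  then show ?thesis by (simp add: kern_def pospow_def)
qed

lemma kern_inner_empty:
  assumes "0 < c" "0 < T" "0 < j" "z / real j < T * (c + z)"
  shows "kern k c T j x z = 0"
proof (rule ccontr)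
  assume "kern k c T j x z \<noteq> 0"
  then have "T * (c + z) < x" "0 \<le> z - real j * x"
    by (auto simp: kern_def pospow_def indicator_def split: if_splits)
  then have "x \<le> z / real j" using assms by (simp add: field_simps)
  then show False using assms \<open>T * (c + z) < x\<close> by simp
qed

lemma kern_inner:
  assumes "0 < c" "0 < T" "0 < j" "0 \<le> z" "T * (c + z) \<le> z / real j"
  shows "(\<integral>\<^sup>+x. ennreal (kern k c T j x z) \<partial>lborel)
      = ennreal (exp (- z) * (inner_part k j z (T * (c + z)) - inner_part k j z (z / real j)))"
    and "0 \<le> exp (- z) * (inner_part k j z (T * (c + z)) - inner_part k j z (z / real j))"
proof -
  let ?S = "{T * (c + z)..z / real j}"
  have pos: "0 \<le> (z - real j * x) ^ k * exp (- x)" if "x \<in> ?S" for x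
    using that assms by (intro mult_nonneg_nonneg zero_le_power) (auto simp: field_simps)
  note HI = has_integral_inner_part[OF assms(5), of z j k]
  show ge: "0 \<le> exp (- z) * (inner_part k j z (T * (c + z)) - inner_part k j z (z / real j))"
    using has_integral_nonneg[OF HI pos] by simp
  have "(\<integral>\<^sup>+x. ennreal (kern k c T j x z) \<partial>lborel)
      = (\<integral>\<^sup>+x. ennreal (exp (- z)) * (ennreal ((z - real j * x) ^ k * exp (- x)) * indicator ?S x) \<partial>lborel)"
  \<comment> \<open>The lower end is excluded in \<open>kern\<close> and included in
    \<open>?S\<close>, a difference of one point.\<close>
  proof (rule nn_integral_cong_AE, use AE_lborel_singleton[of "T * (c + z)"] in eventually_elim)
    case (elim x)
    have A: "0 < T * (c + z)" using assms by (intro mult_pos_pos) auto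
    have B: "0 \<le> z - real j * x \<longleftrightarrow> x \<le> z / real j" using assms by (simp add: field_simps)
    show ?case
    proof (cases "x \<in> ?S")
      case True
      then show ?thesis
        using elim A B pos[OF True] by (auto simp: kern_def pospow_def ennreal_mult[symmetric] mult_ac)
    next
      case False
      then have "\<not> (T * (c + z) < x \<and> 0 \<le> z - real j * x)" using B by auto
      then show ?thesis using False by (auto simp: kern_def pospow_def)
    qed
  qed
  also have "\<dots> = ennreal (exp (- z)) * (\<integral>\<^sup>+x. ennreal ((z - real j * x) ^ k * exp (- x)) * indicator ?S x \<partial>lborel)"
    by (rule nn_integral_cmult) measurable
  also have "(\<integral>\<^sup>+x. ennreal ((z - real j * x) ^ k * exp (- x)) * indicator ?S x \<partial>lborel)
      = ennreal (inner_part k j z (T * (c + z)) - inner_part k j z (z / real j))"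
    by (intro nn_integral_has_integral_lebesgue' HI pos)
  finally show "(\<integral>\<^sup>+x. ennreal (kern k c T j x z) \<partial>lborel)
      = ennreal (exp (- z) * (inner_part k j z (T * (c + z)) - inner_part k j z (z / real j)))"
    using ge by (simp add: ennreal_mult')
qed

lemma nn_integral_kern:
  assumes "0 < c" "0 < T"
  shows "(\<integral>\<^sup>+z. \<integral>\<^sup>+x. ennreal (kern k c T j x z) \<partial>lborel \<partial>lborel) = ennreal (kern_integral k c T j)"
    and "0 \<le> kern_integral k c T j"
proof -
  have "(\<integral>\<^sup>+z. \<integral>\<^sup>+x. ennreal (kern k c T j x z) \<partial>lborel \<partial>lborel) = ennreal (kern_integral k c T j) \<and> 0 \<le> kern_integral k c T j"
  proof (cases "j = 0")
    case True
    let ?f = "\<lambda>z. exp (- (T * c)) * (indicator {0..} z * (z ^ k * exp (- (T + 1) * z)))"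
    have h: "has_bochner_integral lborel ?f (kern_integral k c T j)"
      unfolding kern_integral_def if_P[OF True] using assms
      by (intro has_bochner_integral_mult_right has_bochner_integral_gamma_tail) auto
    moreover have "0 \<le> ?f z" for z by (simp add: indicator_def)
    ultimately show ?thesis
      using True kern_inner_0[OF assms] nn_integral_has_bochner_integral[OF h] has_bochner_integral_ge_0[OF h] by simp
  next
    case j: False
    then have j0: "0 < j" by simp
    show ?thesis
    proof (cases "real j * T < 1")
      case True
      define b where "b = T * c / (1 / real j - T)"
      have d: "0 < 1 / real j - T" using True j0 by (simp add: field_simps)
      then have b: "0 \<le> b" using assms by (simp add: b_def)
      have ge: "b \<le> z \<longleftrightarrow> T * (c + z) \<le> z / real j" for z
        unfolding b_def using d by (simp add: pos_divide_le_eq algebra_simps)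
      let ?f = "\<lambda>z. indicator {b..} z * (exp (- z) * (inner_part k j z (T * (c + z)) - inner_part k j z (z / real j)))"
      have h: "has_bochner_integral lborel ?f (kern_integral k c T j)"
        using has_bochner_integral_outer_part[OF b j0 \<open>0 < T\<close>, of k c] True j
        by (simp add: kern_integral_def b_def)
      have pos: "0 \<le> ?f z" for z
      proof (cases "b \<le> z")
        case True
        then have "0 \<le> z" "T * (c + z) \<le> z / real j" using order_trans[OF b True] ge by blast+
        then show ?thesis using kern_inner(2)[OF assms j0] True by simp
      qed simp
      have "(\<integral>\<^sup>+x. ennreal (kern k c T j x z) \<partial>lborel) = ennreal (?f z)" for z
      proof (cases "b \<le> z")
        case True
        then have "0 \<le> z" "T * (c + z) \<le> z / real j" using order_trans[OF b True] ge by blast+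
        then show ?thesis using kern_inner(1)[OF assms j0] True by simp
      next
        case False
        then have "z / real j < T * (c + z)" using ge by auto
        then show ?thesis using kern_inner_empty[OF assms j0] False by simp
      qed
      then show ?thesis
        using nn_integral_has_bochner_integral[OF h pos] has_bochner_integral_ge_0[OF h pos] by simp
    next
      case False
      have "kern k c T j x z = 0" for x z
      proof (cases "0 \<le> z")
        case True
        have "1 / real j \<le> T" using False j0 by (simp add: field_simps)
        then have "z * (1 / real j) \<le> z * T" using True by (rule mult_left_mono)
        moreover have "0 < T * c" using assms by simp
        ultimately have "z / real j < T * (c + z)" by (simp add: algebra_simps)
        then show ?thesis by (rule kern_inner_empty[OF assms j0])
      next
        case False
        show ?thesis
        proof (cases "0 \<le> x")
          case True
          then have "z - real j * x < 0" using False by (smt (verit) mult_nonneg_nonneg of_nat_0_le_iff)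
          then show ?thesis by (simp add: kern_def pospow_def)
        qed (simp add: kern_def)
      qed
      then show ?thesis using False j by (simp add: kern_integral_def)
    qed
  qed
  then show "(\<integral>\<^sup>+z. \<integral>\<^sup>+x. ennreal (kern k c T j x z) \<partial>lborel \<partial>lborel) = ennreal (kern_integral k c T j)"
    "0 \<le> kern_integral k c T j" by auto
qed

text \<open>Each \<open>kern\<close> is nonnegative, so Tonelli permits integrating over
  \<open>x\<close> first, opposite to the order in \<open>emeasure_covered\<close>, and finiteness
  gives integrability on the plane. The alternating sum can then be integrated termwise; it is again
  nonnegative, being a spline, which leads back to the measure.\<close>

lemma measure_covered:
  assumes N: "N = Suc (Suc k)" and "0 < T" "0 < c"
  shows "measure (\<Pi>\<^sub>M n\<in>{1..N}. exp1) {x \<in> space (\<Pi>\<^sub>M n\<in>{1..N}. exp1). covered N c T x} =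
    real N / fact k * (\<Sum>j\<le>Suc k. (-1) ^ j * real (Suc k choose j) * kern_integral k c T j)"
proof -
  let ?L = "lborel \<Otimes>\<^sub>M (lborel :: real measure) :: (real \<times> real) measure"
  let ?a = "\<lambda>j. (-1) ^ j * real (Suc k choose j) / fact k"
  let ?F = "\<lambda>w. \<Sum>j\<le>Suc k. ?a j * kern k c T j (fst w) (snd w)"
  let ?I = "\<Sum>j\<le>Suc k. ?a j * kern_integral k c T j"
  have "has_bochner_integral ?L (\<lambda>w. kern k c T j (fst w) (snd w)) (kern_integral k c T j)" for j
  proof (rule has_bochner_integral_nn_integral)
    have "(\<integral>\<^sup>+w. ennreal (kern k c T j (fst w) (snd w)) \<partial>?L) = (\<integral>\<^sup>+z. \<integral>\<^sup>+x. ennreal (kern k c T j x z) \<partial>lborel \<partial>lborel)"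
      by (subst lborel_pair.nn_integral_snd[symmetric]) auto
    then show "(\<integral>\<^sup>+w. ennreal (kern k c T j (fst w) (snd w)) \<partial>?L) = ennreal (kern_integral k c T j)"
      using nn_integral_kern(1)[OF assms(3,2)] by simp
  qed (auto simp: kern_nonneg nn_integral_kern(2) assms)
  then have h: "has_bochner_integral ?L ?F ?I"
    by (intro has_bochner_integral_sum has_bochner_integral_mult_right) auto
  have F: "?F w = indicator {0..} (fst w) * indicator {z. T * (c + z) < fst w} (snd w) * exp (- fst w) * exp (- snd w) * spline k (fst w) (snd w)" for w
    by (simp only: kern_def spline_def sum_distrib_left) (intro sum.cong refl, simp)
  have F0: "0 \<le> ?F w" for w
    unfolding F using spline_nonneg[of "fst w" k "snd w"] by (cases "0 \<le> fst w") auto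
  have "(\<integral>\<^sup>+x. ennreal (exp (- x)) * indicator {0..} x *
       (\<integral>\<^sup>+z. ennreal (exp (- z) * spline k x z) * indicator {z. T * (c + z) < x} z \<partial>lborel) \<partial>lborel)
     = (\<integral>\<^sup>+x. \<integral>\<^sup>+z. ennreal (?F (x, z)) \<partial>lborel \<partial>lborel)"
  proof (rule nn_integral_cong)
    fix x :: real
    have "(\<integral>\<^sup>+z. ennreal (?F (x, z)) \<partial>lborel) = (\<integral>\<^sup>+z. ennreal (exp (- x)) * indicator {0..} x *
       (ennreal (exp (- z) * spline k x z) * indicator {z. T * (c + z) < x} z) \<partial>lborel)"
      unfolding F
      by (intro nn_integral_cong) (auto simp: indicator_def ennreal_mult[symmetric] spline_nonneg mult_ac)
    also have "\<dots> = ennreal (exp (- x)) * indicator {0..} x *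
       (\<integral>\<^sup>+z. ennreal (exp (- z) * spline k x z) * indicator {z. T * (c + z) < x} z \<partial>lborel)"
      by (rule nn_integral_cmult) measurable
    finally show "ennreal (exp (- x)) * indicator {0..} x *
       (\<integral>\<^sup>+z. ennreal (exp (- z) * spline k x z) * indicator {z. T * (c + z) < x} z \<partial>lborel)
      = (\<integral>\<^sup>+z. ennreal (?F (x, z)) \<partial>lborel)" by simp
  qed
  also have "\<dots> = (\<integral>\<^sup>+w. ennreal (?F w) \<partial>?L)"
    by (rule lborel.nn_integral_fst) measurable
  also have "\<dots> = ennreal ?I"
    by (rule nn_integral_has_bochner_integral[OF h F0])
  finally have "emeasure (\<Pi>\<^sub>M n\<in>{1..N}. exp1) {x \<in> space (\<Pi>\<^sub>M n\<in>{1..N}. exp1). covered N c T x} = of_nat N * ennreal ?I"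
    using emeasure_covered[OF N \<open>0 < T\<close>, of c] by simp
  moreover have "0 \<le> ?I" by (rule has_bochner_integral_ge_0[OF h F0])
  ultimately have "measure (\<Pi>\<^sub>M n\<in>{1..N}. exp1) {x \<in> space (\<Pi>\<^sub>M n\<in>{1..N}. exp1). covered N c T x} = real N * ?I"
    by (simp add: measure_def enn2real_mult)
  moreover have "?I = (\<Sum>j\<le>Suc k. (-1) ^ j * real (Suc k choose j) * kern_integral k c T j) / fact k"
    by (simp only: sum_divide_distrib times_divide_eq_left)
  ultimately show ?thesis by simp
qed

section \<open>The closed form\<close>

text \<open>The summand of \<open>P_last\<close>, also for \<open>m\<close> below its actual value: \<open>P_mid\<close> is a difference of two of these.\<close>

definition last_term :: "nat \<Rightarrow> real \<Rightarrow> real \<Rightarrow> nat \<Rightarrow> nat \<Rightarrow> nat \<Rightarrow> real" where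
  "last_term N \<rho> T m i l =
     exp (- (T * real N / \<rho>)) * (T ^ l / fact l) * F1 N \<rho> T m i l - 1 / ((real m - 1) ^ l * fact l) * F2 N \<rho> T m i l"

text \<open>The index \<open>t\<close> stands for the power \<open>j = t - 1\<close> of the spline:
  the sign is \<open>(-1) ^ j\<close> and \<open>1 - real t\<close> is
  \<open>- real j\<close>.\<close>

definition xi_term :: "nat \<Rightarrow> (nat \<Rightarrow> nat \<Rightarrow> real) \<Rightarrow> nat \<Rightarrow> real" where
  "xi_term N g t = real ((N - 1) choose (t - 1)) * (-1) ^ (t + 1) *
       (\<Sum>i = 0..N - 2. real ((N - 2) choose i) * (1 - real t) ^ i * fact i * (\<Sum>l = 0..i. g i l))"

lemma xi_eq_sum_xi_term: "xi N p g = real N / fact (N - 2) * (\<Sum>t = 1..p. xi_term N g t)"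
  by (simp add: xi_def xi_term_def)

lemma xi_cong:
  "(\<And>i l. i \<le> N - 2 \<Longrightarrow> l \<le> i \<Longrightarrow> g i l = h i l) \<Longrightarrow> xi N p g = xi N p h"
  unfolding xi_def by (intro arg_cong2[where f="(*)"] sum.cong refl) auto

lemma xi_add: "xi N p g + xi N p h = xi N p (\<lambda>i l. g i l + h i l)"
  unfolding xi_def sum.distrib distrib_left ..

lemma xi_diff: "xi N p g - xi N p h = xi N p (\<lambda>i l. g i l - h i l)"
  unfolding xi_def sum_subtractf right_diff_distrib ..

section \<open>The given terms as incomplete gamma integrals\<close>

lemma gamma_tail_0: "gamma_tail p a 0 = fact p / a ^ (p + 1)"
proof -
  have "(\<Sum>u=0..p. a ^ u * 0 ^ u / fact u) = (\<Sum>u\<in>{0}. a ^ u * 0 ^ u / (fact u :: real))"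
    by (rule sum.mono_neutral_right) auto
  then show ?thesis by (simp add: gamma_tail_def)
qed

lemma F1_eq:
  assumes "i \<le> N - 2" "2 \<le> N"
  shows "F1 N \<rho> T m i l = (\<Sum>v = 0..l. real (l choose v) * (real N / \<rho>) ^ (l - v) * gamma_tail (N - 2 - i + v) (T + 1) (b_th N \<rho> T (m - 1)))"
proof -
  have e: "N - i + v - 2 = N - 2 - i + v" "N - i + v - 1 = N - 2 - i + v + 1" for v using assms by auto
  show ?thesis unfolding F1_def gamma_tail_def e by (intro sum.cong refl) (simp only: times_divide_eq_right[symmetric] mult.assoc)
qed

lemma F2_eq:
  assumes "i \<le> N - 2" "2 \<le> N"
  shows "F2 N \<rho> T m i l = gamma_tail (N - 2 - i + l) (real m / (real m - 1)) (b_th N \<rho> T (m - 1))"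
proof -
  have e: "N - i + l - 2 = N - 2 - i + l" "N - i + l - 1 = N - 2 - i + l + 1" using assms by auto
  show ?thesis unfolding F2_def gamma_tail_def e by (simp only: times_divide_eq_right)
qed

lemma D1_eq:
  assumes "i \<le> N - 2" "2 \<le> N"
  shows "D1 N \<rho> T k i l = F1 N \<rho> T k i l - F1 N \<rho> T (Suc k) i l"
proof -
  have e: "N - i + v - 2 = N - 2 - i + v" "N - i + v - 1 = N - 2 - i + v + 1" for v using assms by auto
  have "(\<Sum>u = 0..p. a ^ u / fact u * (x * b ^ u - y * d ^ u))
      = x * (\<Sum>u = 0..p. a ^ u * b ^ u / fact u) - y * (\<Sum>u = 0..p. a ^ u * d ^ u / fact u)" for p and a b d x y :: real
    unfolding sum_distrib_left sum_subtractf[symmetric] by (intro sum.cong refl) (simp add: field_simps)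
  then show ?thesis
    unfolding F1_eq[OF assms] D1_def gamma_tail_def e sum_subtractf[symmetric] diff_Suc_1
    by (intro sum.cong refl) (simp only: right_diff_distrib mult.assoc)
qed

lemma E1_eq: "E1 N \<rho> T k i l = F2 N \<rho> T (Suc k) i l"
  by (simp add: E1_def F2_def add.commute)

lemma D2_E2_eq: "D2 N \<rho> T k i l + E2 N \<rho> T k i l = F2 N \<rho> T k i l"
  by (simp add: D2_def E2_def F2_def right_diff_distrib mult.assoc)

text \<open>\<open>D1\<close> and \<open>D2\<close> integrate over \<open>z\<close> between
  \<open>b_th N \<rho> T (k - 1)\<close> and \<open>b_th N \<rho> T k\<close>. \<open>E2\<close>
  supplies the missing tail of \<open>D2\<close>, while \<open>E1\<close> is already the
  \<open>F2\<close> of index \<open>k + 1\<close>, so the two brackets together form a difference of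
  last terms.\<close>

lemma P_mid_eq:
  assumes "2 \<le> N"
  shows "P_mid N \<rho> T k = xi N k (last_term N \<rho> T k) - xi N k (last_term N \<rho> T (Suc k))"
  unfolding P_mid_def xi_add xi_diff
proof (rule xi_cong)
  fix i l assume i: "i \<le> N - 2"
  let ?e = "exp (- (T * real N / \<rho>)) * (T ^ l / fact l)" and ?q = "1 / ((real k - 1) ^ l * fact l)"
  have "?e * D1 N \<rho> T k i l - ?q * D2 N \<rho> T k i l + (1 / (real k ^ l * fact l) * E1 N \<rho> T k i l - ?q * E2 N \<rho> T k i l)
    = ?e * (F1 N \<rho> T k i l - F1 N \<rho> T (Suc k) i l) - ?q * (D2 N \<rho> T k i l + E2 N \<rho> T k i l) + 1 / (real k ^ l * fact l) * F2 N \<rho> T (Suc k) i l"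
    unfolding D1_eq[OF i assms] E1_eq by (simp add: algebra_simps)
  then show "?e * D1 N \<rho> T k i l - ?q * D2 N \<rho> T k i l + (1 / (real k ^ l * fact l) * E1 N \<rho> T k i l - ?q * E2 N \<rho> T k i l)
    = last_term N \<rho> T k i l - last_term N \<rho> T (Suc k) i l"
    unfolding D2_E2_eq last_term_def by (simp add: right_diff_distrib)
qed

text \<open>\<open>last_term\<close> of index \<open>k + 1\<close> enters with a minus sign under
  \<open>xi N k\<close> and with a plus sign under \<open>xi N (k + 1)\<close>. These differ only in
  the summand \<open>t = k + 1\<close>, which survives. At the start, index \<open>2\<close> keeps
  both \<open>t = 1\<close> and \<open>t = 2\<close>.\<close>

lemma sum_P_telescope:
  assumes "2 \<le> m" "2 \<le> N"
  shows "(\<Sum>k = 2..m - 1. P_mid N \<rho> T k) + P_last N \<rho> T m =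
    real N / fact (N - 2) * (xi_term N (last_term N \<rho> T 2) 1 + (\<Sum>t = 2..m. xi_term N (last_term N \<rho> T t) t))"
  using assms(1)
proof (induction m rule: dec_induct)
  case base
  have "P_last N \<rho> T 2 = xi N 2 (last_term N \<rho> T 2)"
    by (simp add: P_last_def last_term_def[abs_def])
  also have "\<dots> = real N / fact (N - 2) * (xi_term N (last_term N \<rho> T 2) 1 + xi_term N (last_term N \<rho> T 2) 2)"
    by (simp add: xi_eq_sum_xi_term numeral_2_eq_2)
  finally show ?case by simp
next
  case (step m)
  have L: "P_last N \<rho> T m = xi N m (last_term N \<rho> T m)" for m
    by (simp add: P_last_def last_term_def[abs_def])
  have "{2..Suc m - 1} = insert m {2..m - 1}" "m \<notin> {2..m - 1}" using step by auto
  then have "(\<Sum>k = 2..Suc m - 1. P_mid N \<rho> T k) = P_mid N \<rho> T m + (\<Sum>k = 2..m - 1. P_mid N \<rho> T k)"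
    by simp
  then have "(\<Sum>k = 2..Suc m - 1. P_mid N \<rho> T k) + P_last N \<rho> T (Suc m)
     = (\<Sum>k = 2..m - 1. P_mid N \<rho> T k) + P_last N \<rho> T m
       + (xi N (Suc m) (last_term N \<rho> T (Suc m)) - xi N m (last_term N \<rho> T (Suc m)))"
    unfolding P_mid_eq[OF assms(2), of \<rho> T m] L by simp
  also have "xi N (Suc m) (last_term N \<rho> T (Suc m)) - xi N m (last_term N \<rho> T (Suc m))
     = real N / fact (N - 2) * xi_term N (last_term N \<rho> T (Suc m)) (Suc m)"
    by (simp add: xi_eq_sum_xi_term distrib_left)
  finally show ?case
    unfolding step.IH using step.hyps by (simp add: distrib_left)
qed

text \<open>\<open>C1\<close> integrates the \<open>j = 0\<close> term from \<open>0\<close> to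
  \<open>b_th N \<rho> T 1\<close>, and the leftover \<open>t = 1\<close> term of the telescope
  supplies the rest of the half-line. Its second part, of rate \<open>2\<close>, cancels
  \<open>C2\<close>.\<close>

lemma P_first_plus:
  assumes "2 \<le> N"
  shows "P_first N \<rho> T + real N / fact (N - 2) * xi_term N (last_term N \<rho> T 2) 1
    = real N / fact (N - 2) * kern_integral (N - 2) (real N / \<rho>) T 0"
proof -
  let ?b = "b_th N \<rho> T 1"
  have N1: "N - 1 = N - 2 + 1" using assms by simp
  have C1: "C1 N \<rho> T = gamma_tail (N - 2) (T + 1) 0 - gamma_tail (N - 2) (T + 1) ?b"
    unfolding gamma_tail_0 C1_def N1 by (simp add: gamma_tail_def right_diff_distrib)
  have C2: "C2 N \<rho> T = gamma_tail (N - 2) 2 ?b"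
    unfolding C2_def N1 by (simp add: gamma_tail_def)
  \<comment> \<open>At \<open>t = 1\<close> the base \<open>1 - real t\<close> vanishes, and
    \<open>0 ^ 0 = 1\<close> keeps only \<open>i = 0\<close>.\<close>
  have "(\<Sum>i = 0..N - 2. real ((N - 2) choose i) * (1 - real 1) ^ i * fact i * (\<Sum>l = 0..i. last_term N \<rho> T 2 i l))
     = (\<Sum>i\<in>{0}. real ((N - 2) choose i) * (1 - real 1) ^ i * fact i * (\<Sum>l = 0..i. last_term N \<rho> T 2 i l))"
    by (rule sum.mono_neutral_right) auto
  then have "xi_term N (last_term N \<rho> T 2) 1 = last_term N \<rho> T 2 0 0"
    by (simp add: xi_term_def)
  also have "\<dots> = exp (- (T * real N / \<rho>)) * gamma_tail (N - 2) (T + 1) ?b - gamma_tail (N - 2) 2 ?b"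
    using assms by (simp add: last_term_def F1_eq F2_eq)
  finally have x: "xi_term N (last_term N \<rho> T 2) 1
      = exp (- (T * real N / \<rho>)) * gamma_tail (N - 2) (T + 1) ?b - gamma_tail (N - 2) 2 ?b" .
  show ?thesis
    unfolding P_first_def C1 C2 x distrib_left[symmetric] by (simp add: kern_integral_def right_diff_distrib)
qed

text \<open>On this diagonal the base \<open>- real j\<close>, the lower limit
  \<open>b_th N \<rho> T j\<close> and the rate \<open>(j + 1) / j\<close> all belong to the same
  \<open>j\<close>, so the summand is an \<open>outer_part\<close>.\<close>

lemma xi_term_last_term:
  assumes "1 \<le> j" "real j * T < 1" "2 \<le> N"
  shows "xi_term N (last_term N \<rho> T (Suc j)) (Suc j)
    = (-1) ^ j * real ((N - 1) choose j) * kern_integral (N - 2) (real N / \<rho>) T j"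
proof -
  have b: "b_th N \<rho> T j = T * (real N / \<rho>) / (1 / real j - T)"
    by (simp add: b_th_def)
  have neg: "1 - real (Suc j) = - real j" by simp
  have "outer_part (N - 2) (real N / \<rho>) T (b_th N \<rho> T j) j
     = (\<Sum>i = 0..N - 2. real ((N - 2) choose i) * (1 - real (Suc j)) ^ i * fact i * (\<Sum>l = 0..i. last_term N \<rho> T (Suc j) i l))"
    unfolding outer_part_def atMost_atLeast0 neg
  proof (intro sum.cong refl arg_cong2[where f="(*)"])
    fix i l assume "i \<in> {0..N - 2}"
    then have i: "i \<le> N - 2" by simp
    show "exp (- (T * (real N / \<rho>))) * (T ^ l / fact l) *
        (\<Sum>v = 0..l. real (l choose v) * (real N / \<rho>) ^ (l - v) * gamma_tail (N - 2 - i + v) (T + 1) (b_th N \<rho> T j)) -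
        1 / (real j ^ l * fact l) * gamma_tail (N - 2 - i + l) ((real j + 1) / real j) (b_th N \<rho> T j) =
        last_term N \<rho> T (Suc j) i l"
      unfolding last_term_def F1_eq[OF i assms(3)] F2_eq[OF i assms(3)] by (simp add: add.commute)
  qed
  then show ?thesis
    using assms by (simp add: xi_term_def kern_integral_def b)
qed

text \<open>The ceiling cuts the sum exactly where the integrals vanish, since \<open>j < m\<close>
  is equivalent to \<open>j * T < 1\<close>.\<close>

lemma sum_kern_integral_eq_P:
  assumes "2 \<le> N" "0 < T" "T < 1" "m = nat \<lceil>1 / T\<rceil>"
  shows "real N / fact (N - 2) * (\<Sum>j\<le>N - 1. (-1) ^ j * real ((N - 1) choose j) * kern_integral (N - 2) (real N / \<rho>) T j)
    = P_first N \<rho> T + (\<Sum>k = 2..m - 1. P_mid N \<rho> T k) + P_last N \<rho> T m"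
proof -
  let ?K = "\<lambda>j. (-1) ^ j * real ((N - 1) choose j) * kern_integral (N - 2) (real N / \<rho>) T j"
  have m_iff: "j < m \<longleftrightarrow> real j * T < 1" for j
  proof -
    have "j < m \<longleftrightarrow> int j < \<lceil>1 / T\<rceil>" unfolding assms(4) by linarith
    also have "\<dots> \<longleftrightarrow> real j < 1 / T" by (simp add: less_ceiling_iff)
    finally show ?thesis using assms(2) by (simp add: pos_less_divide_eq)
  qed
  have m2: "2 \<le> m" using m_iff[of 1] assms(3) by simp
  \<comment> \<open>Either of \<open>N - 1\<close> and \<open>m - 1\<close> may be the larger:
    beyond the first the binomial coefficients vanish, beyond the second the integrals do.\<close>
  have "(\<Sum>j\<le>N - 1. ?K j) = (\<Sum>j\<le>max (N - 1) (m - 1). ?K j)"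
    by (rule sum.mono_neutral_left) (auto simp: binomial_eq_0)
  also have "\<dots> = (\<Sum>j\<le>m - 1. ?K j)"
  proof (rule sum.mono_neutral_right)
    show "\<forall>j\<in>{..max (N - 1) (m - 1)} - {..m - 1}. ?K j = 0"
    proof
      fix j assume "j \<in> {..max (N - 1) (m - 1)} - {..m - 1}"
      then have "j \<noteq> 0" "\<not> j < m" by auto
      then show "?K j = 0" by (simp add: kern_integral_def m_iff)
    qed
  qed auto
  also have "\<dots> = ?K 0 + (\<Sum>j = 1..m - 1. ?K j)"
    by (simp add: atMost_atLeast0 sum.atLeast_Suc_atMost)
  also have "(\<Sum>j = 1..m - 1. ?K j) = (\<Sum>j = 1..m - 1. xi_term N (last_term N \<rho> T (Suc j)) (Suc j))"
  proof (rule sum.cong[OF refl])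
    fix j assume "j \<in> {1..m - 1}"
    then have "1 \<le> j" "j < m" by auto
    then show "?K j = xi_term N (last_term N \<rho> T (Suc j)) (Suc j)"
      using xi_term_last_term[of j T N \<rho>] assms(1) m_iff by simp
  qed
  also have "\<dots> = (\<Sum>t = Suc 1..Suc (m - 1). xi_term N (last_term N \<rho> T t) t)"
    by (rule sum.shift_bounds_cl_Suc_ivl[symmetric])
  also have "{Suc 1..Suc (m - 1)} = {2..m}" using m2 by auto
  finally show ?thesis
    using P_first_plus[OF assms(1), of \<rho> T] sum_P_telescope[OF m2 assms(1), of \<rho> T]
    by (simp add: distrib_left)
qed

theorem theorem2:
  fixes M :: "'a measure"
    and H :: "'a \<Rightarrow> complex ^ 'nt ^ 'nr"
    and \<phi> :: "nat \<Rightarrow> 'a \<Rightarrow> complex ^ 'nt"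
    and N :: nat and \<rho> T :: real
  assumes "prob_space M"
    and "1 \<le> N" and "N \<le> CARD('nt)"
    and "0 < \<rho>" and "0 < T"
    and "T < 1 \<Longrightarrow> 2 \<le> N"
    and "iid_gaussian_channel M H"
    and "AE \<omega> in M. orthonormal_family N (\<lambda>n. \<phi> n \<omega>)"
    and "indep_rvs M borel H (\<Pi>\<^sub>M n\<in>{1..N}. borel) (\<lambda>\<omega>. \<lambda>n\<in>{1..N}. \<phi> n \<omega>)"
  shows "coverage_AS M N \<rho> T H \<phi> =
    (if T \<ge> 1 then
       1 - (1 - real N / (T + 1) ^ (N - 1) * exp (- (T * real N / \<rho>))) ^ CARD('nr)
     else
       let m = nat \<lceil>1 / T\<rceil> in
       1 - (1 - (P_first N \<rho> T + (\<Sum>k = 2..m - 1. P_mid N \<rho> T k) + P_last N \<rho> T m)) ^ CARD('nr))"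
proof -
  let ?c = "real N / \<rho>"
  have c: "0 < ?c" using assms(2,4) by simp
  \<comment> \<open>\<open>N \<le> CARD('nt)\<close> provides a separate coordinate axis for every
    beam.\<close>
  obtain \<iota> :: "nat \<Rightarrow> 'nt" where \<iota>: "inj_on \<iota> {1..N}"
    using card_le_inj[of "{1..N}" "UNIV :: 'nt set"] assms(3) by auto
  define p where "p = measure (\<Pi>\<^sub>M n\<in>{1..N}. exp1) {x \<in> space (\<Pi>\<^sub>M n\<in>{1..N}. exp1). covered N ?c T x}"
  have cov: "coverage_AS M N \<rho> T H \<phi> = 1 - (1 - p) ^ CARD('nr)"
    unfolding p_def coverage_AS_eq_axes[OF assms(1,2,4,7-9) \<iota>]
    by (rule iid_gaussian_channel_coverage[OF assms(1,2,7) \<iota>])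
  have p: "p = real N / fact (N - 2) * (\<Sum>j\<le>N - 1. (-1) ^ j * real ((N - 1) choose j) * kern_integral (N - 2) ?c T j)"
    if "2 \<le> N"
  proof -
    have "N = Suc (Suc (N - 2))" "Suc (N - 2) = N - 1" using that by auto
    then show ?thesis
      using measure_covered[of N "N - 2" T ?c] assms(5) c unfolding p_def by simp
  qed
  show ?thesis
  proof (cases "T \<ge> 1")
    case True
    have "p = real N / (T + 1) ^ (N - 1) * exp (- (T * real N / \<rho>))"
    proof (cases "N = 1")
      case N: True
      show ?thesis
        using measure_covered_1[of T ?c] assms(5) c unfolding p_def N by simp
    next
      case False
      then have N: "2 \<le> N" using assms(2) by simp
      have "kern_integral (N - 2) ?c T j = 0" if "j \<noteq> 0" for j
      proof -
        have "1 * 1 \<le> real j * T" using True that by (intro mult_mono) auto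
        then show ?thesis using that by (simp add: kern_integral_def)
      qed
      then have s: "(\<Sum>j\<le>N - 1. (-1) ^ j * real ((N - 1) choose j) * kern_integral (N - 2) ?c T j)
        = (\<Sum>j\<in>{0}. (-1) ^ j * real ((N - 1) choose j) * kern_integral (N - 2) ?c T j)"
        by (intro sum.mono_neutral_right) auto
      have "N - 2 + 1 = N - 1" using N by simp
      then have k0: "kern_integral (N - 2) ?c T 0 = exp (- (T * ?c)) * (fact (N - 2) / (T + 1) ^ (N - 1))"
        unfolding kern_integral_def gamma_tail_0 by (simp only: if_True simp_thms)
      show ?thesis
        unfolding p[OF N] s by (simp add: k0 del: One_nat_def)
    qed
    then show ?thesis using cov True by simp
  next
    case False
    then have "p = P_first N \<rho> T + (\<Sum>k = 2..nat \<lceil>1 / T\<rceil> - 1. P_mid N \<rho> T k) + P_last N \<rho> T (nat \<lceil>1 / T\<rceil>)"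
      using p sum_kern_integral_eq_P[OF _ assms(5) _ refl, of N \<rho>] assms(6) by simp
    then show ?thesis using cov False by (simp add: Let_def)
  qed
qed

end
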